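(* Let $q$ be a prime power, $\ell$ a prime with $\ell\nmid q$, and $g\ge 0$ an integer. Let $\mathfrak{Q}(q,\ell,g)$ be the proportion of matrices in $\mathrm{GSp}_{2g}^{(q)}(\mathbb{F}_\ell)$ having $1$ as an eigenvalue. Then \[ \mathfrak{Q}(q,\ell,g) = \begin{cases} \displaystyle - \sum_{r=1}^g\ell^r \prod_{j=1}^r (1-\ell^{2j})^{-1} & \text{if } \ell \mid q-1, \\ \displaystyle - \sum_{r=1}^g \prod_{j=1}^r (1-\ell^j)^{-1} & \text{if } \ell \nmid q-1. \end{cases}\]
   Context: Let $\Omega=\begin{pmatrix}0&\mathbb{I}_g\\-\mathbb{I}_g&0\end{pmatrix}$ ($2g\times 2g$) and $\mathrm{GSp}_{2g}^{(q)}(\mathbb{F}_\ell)=\{M\in\mathrm{GL}_{2g}(\mathbb{F}_\ell): {}^tM\Omega M=q\Omega\}$, with $q$ read modulo $\ell$. For $g=0$ the set consists of a single matrix which does not have eigenvalue $1$, so $\mathfrak{Q}(q,\ell,0)=0$ (empty sum). *)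

theory Defs
  imports
    Complex_Main
    "HOL-Number_Theory.Prime_Powers"
    "Jordan_Normal_Form.Char_Poly"
    "Berlekamp_Zassenhaus.Finite_Field"
begin

definition Omega_mat :: "nat \<Rightarrow> 'a::field mat" where
  "Omega_mat g = four_block_mat (0\<^sub>m g g) (1\<^sub>m g) (- 1\<^sub>m g) (0\<^sub>m g g)"

text \<open>Despite its customary name, this is only the set of similitudes with multiplier exactly
  the image of \<open>q\<close> in the field, not the whole group of symplectic similitudes.\<close>

definition GSp :: "nat \<Rightarrow> nat \<Rightarrow> 'a::field mat set" where
  "GSp q g = {M \<in> carrier_mat (2 * g) (2 * g).
     invertible_mat M \<and> transpose_mat M * Omega_mat g * M = of_nat q \<cdot>\<^sub>m Omega_mat g}"

text \<open>The prime \<open>\<ell>\<close> is carried by a type \<open>'p :: prime_card\<close> with \<open>CARD('p) = \<ell>\<close>,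
  and \<open>'p mod_ring\<close> is then the field of integers modulo \<open>\<ell>\<close>.
  For \<open>g = 0\<close> there are no nonzero vectors, so the empty matrix has no eigenvalue.\<close>

definition eigenvalue_one_proportion :: "'p::prime_card itself \<Rightarrow> nat \<Rightarrow> nat \<Rightarrow> real" where
  "eigenvalue_one_proportion _ q g =
     real (card {M \<in> (GSp q g :: 'p mod_ring mat set). eigenvalue M 1}) /
     real (card (GSp q g :: 'p mod_ring mat set))"

end

theory Submission
  imports
    Defs
    "HOL-Library.Function_Algebras"
    "HOL-Computational_Algebra.Formal_Power_Series"
begin

text \<open>Write \<open>N(M)\<close> for the number of vectors fixed by a similitude \<open>M\<close>, a power of \<open>\<ell>\<close>. Symplectic
  transvections act transitively on nonzero vectors, so averaging \<open>(N - 1) f(N)\<close> over all similitudes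
  amounts to averaging \<open>f(N)\<close> over those fixing the first vector \<open>e\<close> of a hyperbolic pair \<open>e, f\<close>.
  Such an \<open>M\<close> is determined by the similitude \<open>T\<close> it induces on \<open>e\<^sup>\<bottom> / e\<close>, a vector \<open>b\<close> and a scalar
  \<open>c\<close>, and \<open>N(M) / N(T)\<close> depends only on whether \<open>b\<close> is orthogonal to the fixed space of \<open>T\<close> and,
  for multiplier 1, on whether \<open>c\<close> takes one particular value. With \<open>f(N) = (N - \<ell>) \<dots> (N - \<ell>\<^sup>k)\<close>
  this is a recursion in \<open>g\<close> for the averages of \<open>(N - 1) (N - \<ell>) \<dots> (N - \<ell>\<^sup>k)\<close>, and these determine
  the proportion of similitudes with \<open>N = 1\<close>. For multiplier 1, the resulting double sum collapses by
  a product formula for Euler's \<open>q\<close>-exponential series.\<close>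

section \<open>Similitudes as linear maps\<close>

text \<open>The product \<open>fall k N\<close> = (N - 1)(N - l) ... (N - l^(k-1)) counts linearly
  independent k-tuples of fixed vectors. It suits the recursion because the chance that b is
  orthogonal to the fixed space of T is 1 / N(T), and this denominator cancels: replacing N by l N
  only shifts the roots of the product. The shift by one between f and the averaged product comes
  from the factor N - 1, the number of nonzero fixed vectors. For multiplier other than 1 a fixed
  space is totally isotropic, so the averages vanish for k > g; the others turn out to be 1, and a
  single sum remains. For multiplier 1 a fixed vector may have a component along f. Then c matters,
  the recursion gains a second term, and its solution needs a generating function in two variables.
  The averages recover the proportion with N = 1 through a finite alternating sum that vanishes at N
  = l, ..., l^(2g). This is why N must be known to be a power of l with exponent at most 2g.
  Similitudes of multiplier other than 1 form no group. All transport is by isometries, which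
  preserve this set under composition on either side.\<close>

lemma card_additive_image:
  fixes D :: "'v::ab_group_add \<Rightarrow> 'w::ab_group_add"
  assumes fin: "finite V" and add: "\<And>u v. u \<in> V \<Longrightarrow> v \<in> V \<Longrightarrow> u + v \<in> V"
    and diff: "\<And>u v. u \<in> V \<Longrightarrow> v \<in> V \<Longrightarrow> u - v \<in> V"
    and hom: "\<And>u v. D (u + v) = D u + D v"
  shows "card V = card (D ` V) * card {v \<in> V. D v = 0}"
proof -
  have homd: "D (u - v) = D u - D v" for u v
    using hom[of "u - v" v] by (simp add: algebra_simps)
  have "card {v \<in> V. D v = w} = card {v \<in> V. D v = 0}" if "w \<in> D ` V" for w
  proof -
    from that obtain u where u: "u \<in> V" "D u = w" by auto
    have "bij_betw (\<lambda>v. v + u) {v \<in> V. D v = 0} {v \<in> V. D v = w}"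
      by (rule bij_betw_byWitness[where f' = "\<lambda>v. v - u"]) (auto simp: u add diff hom homd)
    then show ?thesis by (simp add: bij_betw_same_card)
  qed
  moreover have "card V = (\<Sum>w\<in>D ` V. card {v \<in> V. D v = w})"
    using sum.image_gen[OF fin, of "\<lambda>_. 1::nat" D] by simp
  ultimately show ?thesis by simp
qed

section \<open>Coordinate spaces, the standard symplectic form and similitudes\<close>

definition scale :: "'a::times \<Rightarrow> (nat \<Rightarrow> 'a) \<Rightarrow> nat \<Rightarrow> 'a" where
  "scale c v = (\<lambda>i. c * v i)"

definition coords :: "nat \<Rightarrow> (nat \<Rightarrow> 'a::zero) set" where
  "coords n = {v. \<forall>i\<ge>n. v i = 0}"

definition trunc :: "nat \<Rightarrow> (nat \<Rightarrow> 'a::zero) \<Rightarrow> nat \<Rightarrow> 'a" where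
  "trunc n v = (\<lambda>i. if i < n then v i else 0)"

definition unit_at :: "nat \<Rightarrow> nat \<Rightarrow> 'a::zero_neq_one" where
  "unit_at n = (\<lambda>i. if i = n then 1 else 0)"

text \<open>The two members of a hyperbolic pair are adjacent coordinates, unlike in
  \<open>Omega_mat\<close>. Thus the form for \<open>Suc g\<close> is the form for \<open>g\<close>
  plus one summand, and \<open>trunc (2 * g)\<close> projects away the last hyperbolic
  plane.\<close>

definition sympl :: "nat \<Rightarrow> (nat \<Rightarrow> 'a::comm_ring) \<Rightarrow> (nat \<Rightarrow> 'a) \<Rightarrow> 'a" where
  "sympl g u v = (\<Sum>i<g. u (2 * i) * v (2 * i + 1) - u (2 * i + 1) * v (2 * i))"

definition lin :: "((nat \<Rightarrow> 'a::comm_ring_1) \<Rightarrow> nat \<Rightarrow> 'a) \<Rightarrow> bool" where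
  "lin T \<longleftrightarrow> (\<forall>u v. T (u + v) = T u + T v) \<and> (\<forall>c v. T (scale c v) = scale c (T v))"

text \<open>An endomorphism of the space of the first \<open>2 g\<close> coordinates is represented by its extension
  by zero to all functions on \<open>nat\<close>, so that linearity holds without membership conditions.\<close>

definition simil :: "'a::comm_ring_1 \<Rightarrow> nat \<Rightarrow> ((nat \<Rightarrow> 'a) \<Rightarrow> nat \<Rightarrow> 'a) set" where
  "simil q g = {T. lin T \<and> (\<forall>v. T (trunc (2 * g) v) = T v) \<and> (\<forall>v. trunc (2 * g) (T v) = T v) \<and>
     (\<forall>u v. sympl g (T u) (T v) = q * sympl g u v)}"

definition fixed :: "('v \<Rightarrow> 'v) \<Rightarrow> 'v set" where
  "fixed T = {v. T v = v}"

lemma coords_add: "u \<in> coords n \<Longrightarrow> v \<in> coords n \<Longrightarrow> u + v \<in> coords n"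
  for u :: "nat \<Rightarrow> 'a::comm_ring_1"
  by (simp add: coords_def)

lemma coords_diff: "u \<in> coords n \<Longrightarrow> v \<in> coords n \<Longrightarrow> u - v \<in> coords n"
  for u :: "nat \<Rightarrow> 'a::comm_ring_1"
  by (simp add: coords_def)

lemma coords_scale: "v \<in> coords n \<Longrightarrow> scale c v \<in> coords n"
  for v :: "nat \<Rightarrow> 'a::comm_ring_1"
  by (simp add: coords_def scale_def)

lemma zero_in_coords [simp]: "0 \<in> coords n"
  by (simp add: coords_def)

lemma trunc_in_coords [simp]: "trunc n v \<in> coords n"
  by (simp add: coords_def trunc_def)

lemma trunc_trunc [simp]: "trunc n (trunc n v) = trunc n v"
  by (auto simp: trunc_def)

lemma trunc_eq_iff: "trunc n v = v \<longleftrightarrow> v \<in> coords n"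
  by (auto simp: coords_def trunc_def fun_eq_iff)

lemma bij_betw_coords:
  "bij_betw (\<lambda>v. restrict v {..<n}) (coords n) ({..<n} \<rightarrow>\<^sub>E (UNIV :: 'a::zero set))"
proof (rule bij_betw_byWitness[where f' = "trunc n"])
  show "\<forall>v\<in>coords n. trunc n (restrict v {..<n}) = v"
    by (auto simp: coords_def trunc_def fun_eq_iff)
  show "\<forall>v\<in>{..<n} \<rightarrow>\<^sub>E UNIV. restrict (trunc n v) {..<n} = (v :: nat \<Rightarrow> 'a)"
  proof
    fix v :: "nat \<Rightarrow> 'a" assume v: "v \<in> {..<n} \<rightarrow>\<^sub>E UNIV"
    show "restrict (trunc n v) {..<n} = v"
    proof
      fix i show "restrict (trunc n v) {..<n} i = v i"
        using PiE_arb[OF v, of i] by (cases "i < n") (simp_all add: trunc_def)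
    qed
  qed
  show "trunc n ` ({..<n} \<rightarrow>\<^sub>E (UNIV :: 'a set)) \<subseteq> coords n"
    by (simp add: image_subset_iff)
  show "(\<lambda>v. restrict v {..<n}) ` coords n \<subseteq> {..<n} \<rightarrow>\<^sub>E (UNIV :: 'a set)"
    by (simp add: image_subset_iff)
qed

lemma finite_coords [simp]: "finite (coords n :: (nat \<Rightarrow> 'a::{zero,finite}) set)"
  using bij_betw_finite[OF bij_betw_coords[of n, where 'a = 'a]] by (simp add: finite_PiE)

lemma card_coords: "card (coords n :: (nat \<Rightarrow> 'a::{zero,finite}) set) = CARD('a) ^ n"
  using bij_betw_same_card[OF bij_betw_coords[of n, where 'a = 'a]] by (simp add: card_PiE)

lemma lin_zero: "lin T \<Longrightarrow> T 0 = 0"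
proof -
  assume "lin T"
  then have "T (0 + 0) = T 0 + T 0" by (simp only: lin_def)
  then show ?thesis by simp
qed

lemma lin_diff: "lin T \<Longrightarrow> T (u - v) = T u - T v"
proof -
  assume "lin T"
  then have "T ((u - v) + v) = T (u - v) + T v" by (simp only: lin_def)
  then show ?thesis by (simp add: algebra_simps)
qed

lemma sympl_add_left: "sympl g (u + v) w = sympl g u w + sympl g v w"
  by (simp add: sympl_def algebra_simps sum.distrib sum_subtractf)

lemma sympl_add_right: "sympl g u (v + w) = sympl g u v + sympl g u w"
  by (simp add: sympl_def algebra_simps sum.distrib sum_subtractf)

lemma sympl_diff_left: "sympl g (u - v) w = sympl g u w - sympl g v w"
  by (simp add: sympl_def algebra_simps sum.distrib sum_subtractf)

lemma sympl_diff_right: "sympl g u (v - w) = sympl g u v - sympl g u w"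
  by (simp add: sympl_def algebra_simps sum.distrib sum_subtractf)

lemma sympl_scale_left: "sympl g (scale c u) v = c * sympl g u v"
  by (simp add: sympl_def scale_def algebra_simps sum_distrib_left)

lemma sympl_scale_right: "sympl g u (scale c v) = c * sympl g u v"
  by (simp add: sympl_def scale_def algebra_simps sum_distrib_left)

lemma sympl_zero [simp]: "sympl g 0 v = 0" "sympl g v 0 = 0"
  by (simp_all add: sympl_def)

lemma sympl_self [simp]: "sympl g v v = 0"
  by (simp add: sympl_def algebra_simps)

lemma sympl_skew: "sympl g u v = - sympl g v u"
  by (simp add: sympl_def algebra_simps sum.distrib sum_subtractf)

lemma sympl_trunc [simp]:
  "sympl g (trunc (2 * g) u) v = sympl g u v" "sympl g u (trunc (2 * g) v) = sympl g u v"
  by (auto simp: sympl_def trunc_def intro!: sum.cong)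

lemmas sympl_bilinear = sympl_add_left sympl_add_right sympl_diff_left sympl_diff_right
  sympl_scale_left sympl_scale_right

text \<open>Pairing with the partner of a basis vector reads off the corresponding coordinate of
  \<open>u\<close> up to sign.\<close>

lemma sympl_nondegenerate:
  fixes u :: "nat \<Rightarrow> 'a::comm_ring_1"
  assumes u: "u \<in> coords (2 * g)" "u \<noteq> 0"
  obtains v where "v \<in> coords (2 * g)" "sympl g u v \<noteq> 0"
proof -
  from u obtain i where i: "u i \<noteq> 0" by (auto simp: fun_eq_iff)
  with u have ig: "i < 2 * g" by (auto simp: coords_def not_le[symmetric])
  show thesis
  proof (cases "even i")
    case True
    then obtain j where j: "i = 2 * j" by auto
    have "sympl g u (unit_at (2 * j + 1)) = (\<Sum>k<g. if k = j then u (2 * j) else 0)"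
      unfolding sympl_def unit_at_def by (rule sum.cong) auto
    then show thesis
      using that[of "unit_at (2 * j + 1)"] i ig j by (auto simp: coords_def unit_at_def)
  next
    case False
    then obtain j where j: "i = 2 * j + 1" by (auto elim: oddE)
    have "sympl g u (unit_at (2 * j)) = (\<Sum>k<g. if k = j then - u (2 * j + 1) else 0)"
      unfolding sympl_def unit_at_def by (rule sum.cong) auto
    then show thesis
      using that[of "unit_at (2 * j)"] i ig j by (auto simp: coords_def unit_at_def)
  qed
qed

lemma similD:
  assumes "T \<in> simil q g"
  shows "lin T" "T (u + v) = T u + T v" "T (u - v) = T u - T v" "T (scale c v) = scale c (T v)"
    "T 0 = 0" "T (trunc (2 * g) v) = T v" "trunc (2 * g) (T v) = T v" "T v \<in> coords (2 * g)"
    "sympl g (T u) (T v) = q * sympl g u v"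
proof -
  show "lin T" using assms by (simp add: simil_def)
  then show "T (u + v) = T u + T v" "T (u - v) = T u - T v" "T (scale c v) = scale c (T v)" "T 0 = 0"
    by (auto simp: lin_def lin_diff lin_zero)
  show *: "T (trunc (2 * g) v) = T v" "trunc (2 * g) (T v) = T v"
    "sympl g (T u) (T v) = q * sympl g u v"
    using assms by (simp_all add: simil_def)
  then show "T v \<in> coords (2 * g)" by (metis trunc_in_coords)
qed

lemma simil_comp:
  assumes "S \<in> simil p g" "T \<in> simil q g"
  shows "S \<circ> T \<in> simil (p * q) g"
  using similD[OF assms(1)] similD[OF assms(2)] by (auto simp: simil_def lin_def)

lemma finite_simil [simp]: "finite (simil q g :: ((nat \<Rightarrow> 'a::{comm_ring_1,finite}) \<Rightarrow> nat \<Rightarrow> 'a) set)"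
proof (rule inj_on_finite)
  let ?V = "coords (2 * g) :: (nat \<Rightarrow> 'a) set"
  show "finite (?V \<rightarrow>\<^sub>E ?V)" by (simp add: finite_PiE)
  show "(\<lambda>T. restrict T ?V) ` simil q g \<subseteq> ?V \<rightarrow>\<^sub>E ?V"
    using similD(8) by auto
  show "inj_on (\<lambda>T. restrict T ?V) (simil q g)"
  proof (rule inj_onI, rule ext)
    fix S T v assume *: "S \<in> simil q g" "T \<in> simil q g" and eq: "restrict S ?V = restrict T ?V"
    have "S v = S (trunc (2 * g) v)" by (rule similD(6)[OF *(1), symmetric])
    also have "\<dots> = T (trunc (2 * g) v)" using fun_cong[OF eq, of "trunc (2 * g) v"] by simp
    also have "\<dots> = T v" by (rule similD(6)[OF *(2)])
    finally show "S v = T v" .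
  qed
qed

lemma fixed_subset: "T \<in> simil q g \<Longrightarrow> fixed T \<subseteq> coords (2 * g)"
proof
  fix v assume "T \<in> simil q g" "v \<in> fixed T"
  then show "v \<in> coords (2 * g)" using similD(8)[of T q g v] by (simp add: fixed_def)
qed

lemma finite_fixed [simp]:
  fixes T :: "(nat \<Rightarrow> 'a::{comm_ring_1,finite}) \<Rightarrow> nat \<Rightarrow> 'a"
  shows "T \<in> simil q g \<Longrightarrow> finite (fixed T)"
  by (rule finite_subset[OF fixed_subset finite_coords])

lemma zero_in_fixed: "T \<in> simil q g \<Longrightarrow> 0 \<in> fixed T"
  using similD(5) by (simp add: fixed_def)

lemma card_fixed_pos:
  fixes T :: "(nat \<Rightarrow> 'a::{comm_ring_1,finite}) \<Rightarrow> nat \<Rightarrow> 'a"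
  shows "T \<in> simil q g \<Longrightarrow> card (fixed T) > 0"
  using zero_in_fixed[of T q g] finite_fixed[of T q g] by (auto simp: card_gt_0_iff)

section \<open>Transvections and transitivity on nonzero vectors\<close>

definition transvec :: "nat \<Rightarrow> 'a::comm_ring_1 \<Rightarrow> (nat \<Rightarrow> 'a) \<Rightarrow> (nat \<Rightarrow> 'a) \<Rightarrow> nat \<Rightarrow> 'a" where
  "transvec g c w v = trunc (2 * g) v + scale (c * sympl g v w) w"

lemma transvec_simil: "w \<in> coords (2 * g) \<Longrightarrow> transvec g c w \<in> simil 1 g"
proof -
  assume w: "w \<in> coords (2 * g)"
  have "lin (transvec g c w)"
    unfolding lin_def transvec_def sympl_bilinear
    by (auto simp: fun_eq_iff trunc_def scale_def algebra_simps)
  moreover have "trunc (2 * g) (transvec g c w v) = transvec g c w v" for v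
    using w by (auto simp: transvec_def fun_eq_iff trunc_def scale_def coords_def)
  moreover have "sympl g (transvec g c w u) (transvec g c w v) = sympl g u v" for u v
    using sympl_skew[of g w v] by (simp add: transvec_def sympl_bilinear)
  ultimately show ?thesis by (simp add: simil_def transvec_def)
qed

lemma transvec_inverse: "w \<in> coords (2 * g) \<Longrightarrow> transvec g (- c) w \<circ> transvec g c w = trunc (2 * g)"
 unfolding transvec_def comp_def sympl_bilinear sympl_trunc sympl_self
  by (auto simp: fun_eq_iff trunc_def scale_def coords_def)

text \<open>The map \<open>trunc (2 * g)\<close> is the identity element among the isometries of the
  first \<open>2 * g\<close> coordinates. A two-sided inverse belongs to the definition, so
  conjugation is available without a separate argument that isometries are invertible.\<close>

definition same_orbit :: "nat \<Rightarrow> (nat \<Rightarrow> 'a::comm_ring_1) \<Rightarrow> (nat \<Rightarrow> 'a) \<Rightarrow> bool" where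
  "same_orbit g u v \<longleftrightarrow> (\<exists>S\<in>simil 1 g. \<exists>S'\<in>simil 1 g.
     S u = v \<and> S' \<circ> S = trunc (2 * g) \<and> S \<circ> S' = trunc (2 * g))"

lemma same_orbit_trans:
  assumes "same_orbit g u v" "same_orbit g v w"
  shows "same_orbit g u w"
proof -
  from assms(1) obtain S S' where S: "S \<in> simil 1 g" "S' \<in> simil 1 g" "S u = v"
    "S' \<circ> S = trunc (2 * g)" "S \<circ> S' = trunc (2 * g)" by (auto simp: same_orbit_def)
  from assms(2) obtain R R' where R: "R \<in> simil 1 g" "R' \<in> simil 1 g" "R v = w"
    "R' \<circ> R = trunc (2 * g)" "R \<circ> R' = trunc (2 * g)" by (auto simp: same_orbit_def)
  have "R \<circ> S \<in> simil 1 g" "S' \<circ> R' \<in> simil 1 g"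
    using simil_comp[OF R(1) S(1)] simil_comp[OF S(2) R(2)] by simp_all
  moreover have "(S' \<circ> R') \<circ> (R \<circ> S) = trunc (2 * g)"
  proof
    fix x
    have "((S' \<circ> R') \<circ> (R \<circ> S)) x = S' ((R' \<circ> R) (S x))" by simp
    also have "\<dots> = (S' \<circ> S) x" using R(4) similD(7)[OF S(1)] by simp
    finally show "((S' \<circ> R') \<circ> (R \<circ> S)) x = trunc (2 * g) x" using S(4) by simp
  qed
  moreover have "(R \<circ> S) \<circ> (S' \<circ> R') = trunc (2 * g)"
  proof
    fix x
    have "((R \<circ> S) \<circ> (S' \<circ> R')) x = R ((S \<circ> S') (R' x))" by simp
    also have "\<dots> = (R \<circ> R') x" using S(5) similD(7)[OF R(2)] by simp
    finally show "((R \<circ> S) \<circ> (S' \<circ> R')) x = trunc (2 * g) x" using R(5) by simp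
  qed
  moreover have "(R \<circ> S) u = w" using S(3) R(3) by simp
  ultimately show ?thesis unfolding same_orbit_def by blast
qed

text \<open>The transvection along \<open>v - u\<close> moves \<open>u\<close> by a multiple of
  \<open>v - u\<close>. Since \<open>sympl g u (v - u) = sympl g u v\<close>, the chosen constant
  makes this multiple 1.\<close>

lemma same_orbit_nonorthogonal:
  fixes u :: "nat \<Rightarrow> 'a::field"
  assumes u: "u \<in> coords (2 * g)" and v: "v \<in> coords (2 * g)" and ne: "sympl g u v \<noteq> 0"
  shows "same_orbit g u v"
proof -
  let ?w = "v - u" and ?c = "1 / sympl g u v"
  have w: "?w \<in> coords (2 * g)" using u v by (rule coords_diff[rotated])
  have "transvec g ?c ?w u = v"
    using ne trunc_eq_iff[THEN iffD2, OF u]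
    by (simp add: transvec_def sympl_bilinear) (simp add: fun_eq_iff scale_def)
  moreover have "transvec g (- ?c) ?w \<circ> transvec g ?c ?w = trunc (2 * g)"
    "transvec g ?c ?w \<circ> transvec g (- ?c) ?w = trunc (2 * g)"
    using transvec_inverse[OF w, of ?c] transvec_inverse[OF w, of "- ?c"] by simp_all
  ultimately show ?thesis
    using transvec_simil[OF w] unfolding same_orbit_def by blast
qed

text \<open>Two nonorthogonal steps suffice once some \<open>w\<close> is orthogonal to neither
  vector. Such a \<open>w\<close> exists because a space is not the union of two proper subspaces:
  if neither \<open>a\<close> nor \<open>b\<close> serves, their sum does.\<close>

lemma same_orbit_nonzero:
  fixes u :: "nat \<Rightarrow> 'a::field"
  assumes u: "u \<in> coords (2 * g)" "u \<noteq> 0" and v: "v \<in> coords (2 * g)" "v \<noteq> 0"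
  shows "same_orbit g u v"
proof -
  obtain a where a: "a \<in> coords (2 * g)" "sympl g u a \<noteq> 0"
    using sympl_nondegenerate[OF u] by blast
  obtain b where b: "b \<in> coords (2 * g)" "sympl g v b \<noteq> 0"
    using sympl_nondegenerate[OF v] by blast
  obtain w where w: "w \<in> coords (2 * g)" "sympl g u w \<noteq> 0" "sympl g v w \<noteq> 0"
  proof (cases "sympl g v a \<noteq> 0 \<or> sympl g u b \<noteq> 0")
    case True
    then show ?thesis using a b that by blast
  next
    case False
    then show ?thesis using a b that[of "a + b"] by (simp add: coords_add sympl_bilinear)
  qed
  then have "sympl g w v \<noteq> 0" using sympl_skew[of g w v] by simp
  with w u(1) v(1) show ?thesis
    using same_orbit_nonorthogonal same_orbit_trans by blast
qed

text \<open>The first and third facts transport sums of f(N) from one stabilizer to another. The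
  second shows that the fibres of evaluation at a vector have equal size, which replaces
  orbit-stabilizer when \<open>simil q g\<close> is not a group.\<close>

lemma conj_bij:
  assumes S: "S \<in> simil 1 g" "S' \<in> simil 1 g" "S u = v" "S' \<circ> S = trunc (2 * g)" "S \<circ> S' = trunc (2 * g)"
    and u: "u \<in> coords (2 * g)"
  shows "bij_betw (\<lambda>T. S \<circ> T \<circ> S') {T \<in> simil q g. T u = u} {T \<in> simil q g. T v = v}"
    and "bij_betw (\<lambda>T. S \<circ> T) {T \<in> simil q g. T u = u} {T \<in> simil q g. T u = v}"
    and "\<And>T. T \<in> simil q g \<Longrightarrow> card (fixed (S \<circ> T \<circ> S')) = card (fixed T)"
proof -
  have S'v: "S' v = u" using fun_cong[OF S(4), of u] S(3) u by (simp add: trunc_eq_iff[THEN iffD2])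
  have SS: "S (S' x) = trunc (2 * g) x" "S' (S x) = trunc (2 * g) x" for x
    using fun_cong[OF S(5)] fun_cong[OF S(4)] by auto
  have cm: "S \<circ> T \<in> simil q g" "S' \<circ> T \<in> simil q g" "S \<circ> T \<circ> S' \<in> simil q g" "S' \<circ> T \<circ> S \<in> simil q g"
    if "T \<in> simil q g" for T
    using simil_comp[OF S(1) that] simil_comp[OF S(2) that]
      simil_comp[OF simil_comp[OF S(1) that] S(2)] simil_comp[OF simil_comp[OF S(2) that] S(1)]
    by simp_all
  have Tr: "T (trunc (2 * g) x) = T x" "trunc (2 * g) (T x) = T x" if "T \<in> simil q g" for T x
    using that by (simp_all only: similD(6,7))
  have eq: "S' \<circ> (S \<circ> T) = T" "S \<circ> (S' \<circ> T) = T"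
    "S' \<circ> (S \<circ> T \<circ> S') \<circ> S = T" "S \<circ> (S' \<circ> T \<circ> S) \<circ> S' = T" if "T \<in> simil q g" for T
    using Tr[OF that] by (simp_all add: fun_eq_iff SS)
  show "bij_betw (\<lambda>T. S \<circ> T \<circ> S') {T \<in> simil q g. T u = u} {T \<in> simil q g. T v = v}"
    by (rule bij_betw_byWitness[where f' = "\<lambda>T. S' \<circ> T \<circ> S"])
      (simp_all add: image_subset_iff cm eq S'v S(3))
  show "bij_betw (\<lambda>T. S \<circ> T) {T \<in> simil q g. T u = u} {T \<in> simil q g. T u = v}"
    by (rule bij_betw_byWitness[where f' = "\<lambda>T. S' \<circ> T"])
      (simp_all add: image_subset_iff cm eq S'v S(3))
  fix T assume T: "T \<in> simil q g"
  have Tr: "T (trunc (2 * g) x) = T x" "trunc (2 * g) (T x) = T x"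
    "S (trunc (2 * g) x) = S x" "trunc (2 * g) (S x) = S x" "trunc (2 * g) (S' x) = S' x" for x
    using T S(1,2) by (simp_all only: similD(6,7))
  have "bij_betw S (fixed T) (fixed (S \<circ> T \<circ> S'))"
  proof (rule bij_betw_byWitness[where f' = S'])
    show "\<forall>x\<in>fixed T. S' (S x) = x"
    proof
      fix x assume "x \<in> fixed T"
      then have "T x = x" by (simp add: fixed_def)
      then show "S' (S x) = x" using Tr(2)[of x] by (simp add: SS)
    qed
    show "\<forall>x\<in>fixed (S \<circ> T \<circ> S'). S (S' x) = x"
    proof
      fix x assume "x \<in> fixed (S \<circ> T \<circ> S')"
      then have "S (T (S' x)) = x" by (simp add: fixed_def)
      then show "S (S' x) = x" using Tr(4)[of "T (S' x)"] by (simp add: SS)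
    qed
    show "S ` fixed T \<subseteq> fixed (S \<circ> T \<circ> S')" by (auto simp: fixed_def SS Tr)
    show "S' ` fixed (S \<circ> T \<circ> S') \<subseteq> fixed T"
    proof (clarsimp simp: fixed_def)
      fix x assume "S (T (S' x)) = x"
      then have "S' x = S' (S (T (S' x)))" by simp
      then show "T (S' x) = S' x" by (simp add: SS Tr)
    qed
  qed
  then show "card (fixed (S \<circ> T \<circ> S')) = card (fixed T)" by (simp add: bij_betw_same_card)
qed

section \<open>The stabilizer of a vector\<close>

text \<open>The ambient rank is \<open>Suc g\<close>: the fixed vector is the first member e of the
  last hyperbolic pair, and the index \<open>g\<close> is the rank of the similitude induced on the
  remaining coordinates.\<close>

definition stab :: "'a::comm_ring_1 \<Rightarrow> nat \<Rightarrow> ((nat \<Rightarrow> 'a) \<Rightarrow> nat \<Rightarrow> 'a) set" where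
  "stab q g = {T \<in> simil q (Suc g). T (unit_at (2 * g)) = unit_at (2 * g)}"

lemma unit_at_in_coords: "i < n \<Longrightarrow> unit_at i \<in> coords n"
  by (auto simp: unit_at_def coords_def)

lemma unit_at_nonzero: "unit_at i \<noteq> (0 :: nat \<Rightarrow> 'a::zero_neq_one)"
proof
  assume "unit_at i = (0 :: nat \<Rightarrow> 'a)"
  from fun_cong[OF this, of i] show False by (simp add: unit_at_def)
qed

lemma sum_fixing_eq_sum_stab:
  fixes q :: "'a::{field,finite}"
  assumes v: "v \<in> coords (2 * Suc g)" "v \<noteq> 0"
  shows "(\<Sum>T | T \<in> simil q (Suc g) \<and> T v = v. f (card (fixed T))) =
    (\<Sum>T\<in>stab q g. f (card (fixed T)) :: real)"
proof -
  let ?e = "unit_at (2 * g)"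
  have e: "?e \<in> coords (2 * Suc g)" by (simp add: unit_at_in_coords)
  obtain S S' where S: "S \<in> simil 1 (Suc g)" "S' \<in> simil 1 (Suc g)" "S ?e = v"
    "S' \<circ> S = trunc (2 * Suc g)" "S \<circ> S' = trunc (2 * Suc g)"
    using same_orbit_nonzero[OF e unit_at_nonzero v] by (auto simp only: same_orbit_def)
  show ?thesis
    unfolding stab_def
    by (rule sum.reindex_bij_betw[OF conj_bij(1)[OF S e], symmetric, THEN trans])
      (auto intro!: sum.cong simp only: conj_bij(3)[OF S e])
qed

lemma card_mapping_eq_card_stab:
  fixes q :: "'a::{field,finite}"
  assumes v: "v \<in> coords (2 * Suc g)" "v \<noteq> 0"
  shows "card {T \<in> simil q (Suc g). T (unit_at (2 * g)) = v} = card (stab q g)"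
proof -
  let ?e = "unit_at (2 * g)"
  have e: "?e \<in> coords (2 * Suc g)" by (simp add: unit_at_in_coords)
  obtain S S' where S: "S \<in> simil 1 (Suc g)" "S' \<in> simil 1 (Suc g)" "S ?e = v"
    "S' \<circ> S = trunc (2 * Suc g)" "S \<circ> S' = trunc (2 * Suc g)"
    using same_orbit_nonzero[OF e unit_at_nonzero v] by (auto simp only: same_orbit_def)
  show ?thesis
    unfolding stab_def using bij_betw_same_card[OF conj_bij(2)[OF S e, of q]] by simp
qed

text \<open>This lets statements about the possible numbers of fixed vectors be proved by induction
  on \<open>g\<close>, because elements of \<open>stab\<close> have a block form over rank
  \<open>g\<close>.\<close>

lemma ex_stab_card_fixed:
  fixes q :: "'a::{field,finite}"
  assumes T: "T \<in> simil q (Suc g)" "card (fixed T) \<noteq> 1"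
  shows "\<exists>T'\<in>stab q g. card (fixed T') = card (fixed T)"
proof -
  let ?e = "unit_at (2 * g)"
  have e: "?e \<in> coords (2 * Suc g)" by (simp add: unit_at_in_coords)
  have "fixed T \<noteq> {0}" using T by auto
  then obtain v where v: "v \<noteq> 0" "T v = v" using zero_in_fixed[OF T(1)] by (auto simp: fixed_def)
  then have vc: "v \<in> coords (2 * Suc g)" using similD(8)[OF T(1), of v] by simp
  obtain S S' where S: "S \<in> simil 1 (Suc g)" "S' \<in> simil 1 (Suc g)" "S v = ?e"
    "S' \<circ> S = trunc (2 * Suc g)" "S \<circ> S' = trunc (2 * Suc g)"
    using same_orbit_nonzero[OF vc v(1) e unit_at_nonzero] by (auto simp only: same_orbit_def)
  have "S \<circ> T \<circ> S' \<in> stab q g"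
    using conj_bij(1)[OF S vc, of q] T(1) v(2) unfolding stab_def bij_betw_def by blast
  then show ?thesis using conj_bij(3)[OF S vc T(1)] by blast
qed

text \<open>Double counting of pairs of a similitude and a nonzero vector fixed by it. By
  transitivity each of the nonzero vectors contributes the same sum.\<close>

lemma sum_fixed_weighted:
  fixes q :: "'a::{field,finite}"
  shows "(\<Sum>T\<in>simil q (Suc g). (real (card (fixed T)) - 1) * f (card (fixed T))) =
    (real CARD('a) ^ (2 * Suc g) - 1) * (\<Sum>T\<in>stab q g. f (card (fixed T)))"
proof -
  let ?V = "coords (2 * Suc g) - {0} :: (nat \<Rightarrow> 'a) set"
  have finV: "finite ?V" by (intro finite_Diff finite_coords)
  have cV: "real (card ?V) = real CARD('a) ^ (2 * Suc g) - 1"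
    using card_coords[where 'a = 'a, of "2 * Suc g"] finite_coords[of "2 * Suc g", where 'a = 'a]
    by (simp add: card_Diff_singleton del: mult_Suc_right power_Suc)
  have "(\<Sum>T\<in>simil q (Suc g). (real (card (fixed T)) - 1) * f (card (fixed T))) =
    (\<Sum>T\<in>simil q (Suc g). \<Sum>v | v \<in> ?V \<and> T v = v. f (card (fixed T)))"
  proof (rule sum.cong[OF refl])
    fix T :: "(nat \<Rightarrow> 'a) \<Rightarrow> nat \<Rightarrow> 'a" assume T: "T \<in> simil q (Suc g)"
    have "{v. v \<in> ?V \<and> T v = v} = fixed T - {0}"
      using fixed_subset[OF T] by (auto simp: fixed_def)
    then have "real (card {v. v \<in> ?V \<and> T v = v}) = real (card (fixed T)) - 1"
      using zero_in_fixed[OF T] finite_fixed[OF T] card_fixed_pos[OF T]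
      by (simp add: card_Diff_singleton)
    then show "(real (card (fixed T)) - 1) * f (card (fixed T)) =
      (\<Sum>v | v \<in> ?V \<and> T v = v. f (card (fixed T)))" by simp
  qed
  also have "\<dots> = (\<Sum>v\<in>?V. \<Sum>T | T \<in> simil q (Suc g) \<and> T v = v. f (card (fixed T)))"
    by (rule sum.swap_restrict[OF finite_simil finV])
  also have "\<dots> = (\<Sum>v\<in>?V. \<Sum>T\<in>stab q g. f (card (fixed T)))"
    by (rule sum.cong[OF refl]) (rule sum_fixing_eq_sum_stab, auto)
  finally show ?thesis using cV by simp
qed

section \<open>Block form of the stabilizer\<close>

lemma sympl_Suc:
  "sympl (Suc g) u v = sympl g u v + (u (2 * g) * v (Suc (2 * g)) - u (Suc (2 * g)) * v (2 * g))"
  by (simp add: sympl_def)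

lemma sympl_unit_at:
  fixes v :: "nat \<Rightarrow> 'a::comm_ring_1"
  shows
  "sympl (Suc g) (unit_at (2 * g)) v = v (Suc (2 * g))"
  "sympl (Suc g) v (unit_at (Suc (2 * g))) = v (2 * g)"
proof -
  have "sympl g (unit_at (2 * g)) v = 0" "sympl g v (unit_at (Suc (2 * g))) = 0"
    by (auto simp: sympl_def unit_at_def intro!: sum.neutral)
  then show "sympl (Suc g) (unit_at (2 * g)) v = v (Suc (2 * g))"
    "sympl (Suc g) v (unit_at (Suc (2 * g))) = v (2 * g)"
    by (simp_all add: sympl_Suc, simp_all add: unit_at_def)
qed

text \<open>The image of e under a similitude is nonzero, because its pairing with the image of f is
  \<open>q\<close>. The fibres over the nonzero vectors all have the size of the stabilizer.\<close>

lemma card_simil_Suc: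
  fixes q :: "'a::{field,finite}"
  assumes q: "q \<noteq> 0"
  shows "real (card (simil q (Suc g))) = (real CARD('a) ^ (2 * Suc g) - 1) * real (card (stab q g))"
proof -
  let ?V = "coords (2 * Suc g) - {0} :: (nat \<Rightarrow> 'a) set"
  let ?ev = "\<lambda>T. T (unit_at (2 * g)) :: nat \<Rightarrow> 'a"
  have finV: "finite ?V" by (intro finite_Diff finite_coords)
  have cV: "real (card ?V) = real CARD('a) ^ (2 * Suc g) - 1"
    using card_coords[where 'a = 'a, of "2 * Suc g"] finite_coords[of "2 * Suc g", where 'a = 'a]
    by (simp add: card_Diff_singleton del: mult_Suc_right power_Suc)
  have "?ev ` simil q (Suc g) \<subseteq> ?V"
  proof (rule image_subsetI)
    fix T :: "(nat \<Rightarrow> 'a) \<Rightarrow> nat \<Rightarrow> 'a" assume T: "T \<in> simil q (Suc g)"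
    have "sympl (Suc g) (?ev T) (T (unit_at (Suc (2 * g)))) = q"
      by (simp add: similD(9)[OF T] sympl_unit_at) (simp add: unit_at_def)
    then have "?ev T \<noteq> 0" using q by auto
    then show "?ev T \<in> ?V" using similD(8)[OF T] by blast
  qed
  then have "card (simil q (Suc g)) = (\<Sum>v\<in>?V. card {T \<in> simil q (Suc g). ?ev T = v})"
    using sum.group[OF finite_simil finV, of ?ev q "Suc g" "\<lambda>_. 1::nat"] by simp
  also have "\<dots> = (\<Sum>v\<in>?V. card (stab q g))"
    by (rule sum.cong[OF refl]) (rule card_mapping_eq_card_stab, auto)
  also have "\<dots> = card ?V * card (stab q g)" by simp
  finally show ?thesis by (simp only: of_nat_mult cV)
qed

text \<open>With respect to \<open>e\<close>, the first \<open>2 g\<close> coordinates and \<open>f\<close>, this is block upper triangular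
  with diagonal \<open>1, T, q\<close>; the row above \<open>T\<close> is forced by orthogonality to the image of \<open>f\<close>.\<close>

definition extend :: "'a::field \<Rightarrow> nat \<Rightarrow> ((nat \<Rightarrow> 'a) \<Rightarrow> nat \<Rightarrow> 'a) \<Rightarrow> (nat \<Rightarrow> 'a) \<Rightarrow> 'a
    \<Rightarrow> (nat \<Rightarrow> 'a) \<Rightarrow> nat \<Rightarrow> 'a" where
  "extend q g T b c v = (\<lambda>i. if i < 2 * g then T v i + v (Suc (2 * g)) * b i
     else if i = 2 * g then v (2 * g) - sympl g (T v) b / q + c * v (Suc (2 * g))
     else if i = Suc (2 * g) then q * v (Suc (2 * g)) else 0)"

lemma trunc_extend:
  assumes "T \<in> simil q g" "b \<in> coords (2 * g)"
  shows "trunc (2 * g) (extend q g T b c v) = T v + scale (v (Suc (2 * g))) b"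
proof
  fix i
  have "T v i = 0" "b i = 0" if "\<not> i < 2 * g"
    using that similD(8)[OF assms(1), of v] assms(2) by (auto simp: coords_def)
  then show "trunc (2 * g) (extend q g T b c v) i = (T v + scale (v (Suc (2 * g))) b) i"
    by (auto simp: trunc_def extend_def scale_def)
qed

lemma extend_in_stab:
  assumes q: "q \<noteq> 0" and T: "T \<in> simil q g" and b: "b \<in> coords (2 * g)"
  shows "extend q g T b c \<in> stab q g"
proof -
  let ?E = "extend q g T b c"
  note D = similD[OF T]
  have lin: "lin ?E"
    by (auto simp: lin_def extend_def D(2,4) sympl_bilinear fun_eq_iff, auto simp: scale_def field_simps q)
  have t1: "?E (trunc (2 * Suc g) v) = ?E v" for v
  proof -
    have "T (trunc (2 * Suc g) v) = T (trunc (2 * g) (trunc (2 * Suc g) v))" by (simp only: D(6))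
    also have "trunc (2 * g) (trunc (2 * Suc g) v) = trunc (2 * g) v" by (auto simp: trunc_def)
    finally have *: "T (trunc (2 * Suc g) v) = T v" by (simp only: D(6))
    show ?thesis unfolding extend_def * by (auto simp: trunc_def fun_eq_iff)
  qed
  have t2: "trunc (2 * Suc g) (?E v) = ?E v" for v
    by (auto simp: trunc_def extend_def)
  have s: "sympl (Suc g) (?E u) (?E v) = q * sympl (Suc g) u v" for u v
  proof -
    have "sympl g (?E u) (?E v) = sympl g (trunc (2 * g) (?E u)) (trunc (2 * g) (?E v))" by simp
    also have "\<dots> = q * sympl g u v + v (Suc (2 * g)) * sympl g (T u) b - u (Suc (2 * g)) * sympl g (T v) b"
      using sympl_skew[of g b "T v"]
      unfolding trunc_extend[OF T b] sympl_bilinear D(9) by (simp add: algebra_simps)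
    finally have eq: "sympl g (?E u) (?E v) =
      q * sympl g u v + v (Suc (2 * g)) * sympl g (T u) b - u (Suc (2 * g)) * sympl g (T v) b" .
    have E: "?E w (2 * g) = w (2 * g) - sympl g (T w) b / q + c * w (Suc (2 * g))"
      "?E w (Suc (2 * g)) = q * w (Suc (2 * g))" for w
      by (simp_all add: extend_def)
    \<comment> \<open>The cross terms in \<open>b\<close> left by the middle block cancel against
      the entries \<open>- sympl g (T v) b / q\<close> of the top row; the terms in \<open>c\<close>
      cancel by antisymmetry.\<close>
    show ?thesis
      unfolding sympl_Suc eq E using q by (simp add: field_simps)
  qed
  have "T (unit_at (2 * g)) = T (trunc (2 * g) (unit_at (2 * g)))" by (simp only: D(6))
  also have "trunc (2 * g) (unit_at (2 * g)) = (0 :: nat \<Rightarrow> 'a)" by (auto simp: trunc_def unit_at_def)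
  finally have "T (unit_at (2 * g)) = 0" by (simp only: D(5))
  then have "?E (unit_at (2 * g)) = unit_at (2 * g)"
    by (auto simp: extend_def) (auto simp: unit_at_def)
  with lin t1 t2 s show ?thesis by (simp add: stab_def simil_def)
qed

text \<open>The inverse reads \<open>T\<close> off the middle block, and \<open>b\<close> and
  \<open>c\<close> off the image of f. All other entries are forced by preservation of the
  form.\<close>

lemma bij_betw_extend:
  assumes q: "q \<noteq> (0 :: 'a::field)"
  shows "bij_betw (\<lambda>(T, b, c). extend q g T b c) (simil q g \<times> coords (2 * g) \<times> UNIV) (stab q g)"
proof -
  let ?f = "unit_at (Suc (2 * g)) :: nat \<Rightarrow> 'a"
  let ?e = "unit_at (2 * g) :: nat \<Rightarrow> 'a"
  have f0: "trunc (2 * g) ?f = 0" by (auto simp: trunc_def unit_at_def)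
  have f1: "?f (Suc (2 * g)) = 1" "?f (2 * g) = 0" by (auto simp: unit_at_def)
  let ?E = "\<lambda>(T, b, c). extend q g T b c"
  let ?D = "\<lambda>T. (\<lambda>v. trunc (2 * g) (T (trunc (2 * g) v)), trunc (2 * g) (T ?f), T ?f (2 * g))"
  have E: "?E ` (simil q g \<times> coords (2 * g) \<times> UNIV) \<subseteq> stab q g"
    using extend_in_stab[OF q] by auto
  have DE: "\<forall>a\<in>simil q g \<times> coords (2 * g) \<times> UNIV. ?D (?E a) = a"
  proof
    fix a assume "a \<in> simil q g \<times> (coords (2 * g) :: (nat \<Rightarrow> 'a) set) \<times> (UNIV :: 'a set)"
    then obtain T b c where a: "a = (T, b, c)" and T: "T \<in> simil q g" and b: "b \<in> coords (2 * g)"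
      by auto
    have Tf: "T ?f = 0"
    proof -
      have "T ?f = T (trunc (2 * g) ?f)" by (simp only: similD(6)[OF T])
      then show ?thesis using f0 similD(5)[OF T] by simp
    qed
    have 1: "trunc (2 * g) (extend q g T b c (trunc (2 * g) v)) = T v" for v
      by (simp add: trunc_extend[OF T b] similD(6)[OF T]) (simp add: trunc_def scale_def fun_eq_iff)
    have 2: "trunc (2 * g) (extend q g T b c ?f) = b"
      by (simp add: trunc_extend[OF T b] Tf f1) (simp add: scale_def)
    have 3: "extend q g T b c ?f (2 * g) = c"
      by (simp add: extend_def Tf f1)
    show "?D (?E a) = a"
      by (simp only: a prod.case 1 2 3)
  qed
  \<comment> \<open>Pairing with the fixed vector e determines the coordinate along f of every
    image. Orthogonality of the middle space to f then determines the coordinate along e of the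
    images of middle vectors.\<close>
  have stabD: "T \<in> simil q (Suc g)" "T ?e = ?e" "T w (Suc (2 * g)) = q * w (Suc (2 * g))"
    "T (trunc (2 * g) w) (2 * g) = - sympl g (T (trunc (2 * g) w)) (T ?f) / q"
    if "T \<in> stab q g" for T w
  proof -
    show T: "T \<in> simil q (Suc g)" and e: "T ?e = ?e" using that by (simp_all add: stab_def)
    have *: "T w (Suc (2 * g)) = q * w (Suc (2 * g))" for w
      using similD(9)[OF T, of ?e w] unfolding e by (simp add: sympl_unit_at)
    then show "T w (Suc (2 * g)) = q * w (Suc (2 * g))" .
    have "sympl (Suc g) (T (trunc (2 * g) w)) (T ?f) = 0"
      unfolding similD(9)[OF T] by (simp add: sympl_unit_at) (simp add: trunc_def)
    then have "sympl g (T (trunc (2 * g) w)) (T ?f) + T (trunc (2 * g) w) (2 * g) * q = 0"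
      unfolding sympl_Suc * by (simp add: f1) (simp add: trunc_def)
    then show "T (trunc (2 * g) w) (2 * g) = - sympl g (T (trunc (2 * g) w)) (T ?f) / q"
      using q by (simp add: field_simps eq_neg_iff_add_eq_0 add.commute)
  qed
  have D: "?D ` stab q g \<subseteq> simil q g \<times> coords (2 * g) \<times> UNIV"
  proof (rule image_subsetI)
    fix T assume S: "T \<in> stab q g"
    note T = stabD(1)[OF S]
    have "sympl g (T (trunc (2 * g) u)) (T (trunc (2 * g) v)) = q * sympl g u v" for u v
    proof -
      have "sympl (Suc g) (T (trunc (2 * g) u)) (T (trunc (2 * g) v)) =
          q * sympl (Suc g) (trunc (2 * g) u) (trunc (2 * g) v)" by (rule similD(9)[OF T])
      then show ?thesis unfolding sympl_Suc stabD(3)[OF S] by (simp, simp add: trunc_def)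
    qed
    moreover have "trunc (2 * g) (u + v) = trunc (2 * g) u + trunc (2 * g) v"
      "trunc (2 * g) (scale c v) = scale c (trunc (2 * g) v)" for u v :: "nat \<Rightarrow> 'a" and c
      by (auto simp: trunc_def scale_def fun_eq_iff)
    ultimately have "(\<lambda>v. trunc (2 * g) (T (trunc (2 * g) v))) \<in> simil q g"
      by (simp add: simil_def lin_def similD(2,4)[OF T])
    then show "?D T \<in> simil q g \<times> coords (2 * g) \<times> UNIV" by simp
  qed
  have ED: "\<forall>T\<in>stab q g. ?E (?D T) = T"
  proof
    fix T assume S: "T \<in> stab q g"
    note T = stabD(1)[OF S]
    have "extend q g (\<lambda>v. trunc (2 * g) (T (trunc (2 * g) v))) (trunc (2 * g) (T ?f)) (T ?f (2 * g)) = T"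
      (is "?X = T")
    proof (intro ext)
      fix v i
      have "T v = T (trunc (2 * Suc g) v)" by (simp only: similD(6)[OF T])
      also have "trunc (2 * Suc g) v =
          trunc (2 * g) v + (scale (v (2 * g)) ?e + scale (v (Suc (2 * g))) ?f)"
        by (auto simp: trunc_def scale_def unit_at_def fun_eq_iff)
          (rule arg_cong[of _ _ v], linarith)
      finally have "T v = T (trunc (2 * g) v) + (scale (v (2 * g)) ?e + scale (v (Suc (2 * g))) (T ?f))"
        by (simp only: similD(2,4)[OF T] stabD(2)[OF S])
      then have Tv: "T v j = T (trunc (2 * g) v) j + (v (2 * g) * ?e j + v (Suc (2 * g)) * T ?f j)" for j
        by (simp add: scale_def)
      consider "i < 2 * g" | "i = 2 * g" | "i = Suc (2 * g)" | "i \<ge> 2 * Suc g" by fastforce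
      then show "?X v i = T v i"
      proof cases
        case 1
        then show ?thesis by (simp add: extend_def Tv) (simp add: trunc_def unit_at_def)
      next
        case 2
        then show ?thesis
          by (simp add: extend_def Tv[of "2 * g"] stabD(4)[OF S]) (simp add: unit_at_def)
      next
        case 3
        then show ?thesis by (simp add: extend_def stabD(3)[OF S])
      next
        case 4
        then show ?thesis
          using similD(8)[OF T, of v] by (simp add: extend_def coords_def)
      qed
    qed
    then show "?E (?D T) = T" by simp
  qed
  show ?thesis by (rule bij_betw_byWitness[OF DE ED E D])
qed

text \<open>As e itself is fixed, the coordinate along e is free and contributes the factor
  \<open>CARD('a)\<close>. The three conditions are what remains of the middle block, of the row of
  e and of the row of f.\<close>

lemma card_fixed_extend:
  fixes q :: "'a::{field,finite}"
  assumes T: "T \<in> simil q g" and b: "b \<in> coords (2 * g)"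
  shows "card (fixed (extend q g T b c)) = CARD('a) * card {(y, z). y \<in> coords (2 * g) \<and>
    T y + scale z b = y \<and> sympl g (T y) b / q = c * z \<and> q * z = z}"
proof -
  let ?S = "{(y, z). y \<in> coords (2 * g) \<and>
    T y + scale z b = y \<and> sympl g (T y) b / q = c * z \<and> q * z = z}"
  let ?h = "\<lambda>(x, y, z). \<lambda>i. if i < 2 * g then y i else if i = 2 * g then x
     else if i = Suc (2 * g) then z else (0 :: 'a)"
  let ?E = "extend q g T b c"
  have tr: "trunc (2 * g) (?h (x, y, z)) = y" if "y \<in> coords (2 * g)" for x y z
    using that by (auto simp: trunc_def coords_def fun_eq_iff)
  have Th: "T (?h (x, y, z)) = T y" if "y \<in> coords (2 * g)" for x y z
    using similD(6)[OF T, of "?h (x, y, z)"] unfolding tr[OF that] by (rule sym)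
  have "bij_betw ?h (UNIV \<times> ?S) (fixed ?E)"
  proof (rule bij_betw_byWitness[where f' = "\<lambda>v. (v (2 * g), trunc (2 * g) v, v (Suc (2 * g)))"])
    show "\<forall>a\<in>UNIV \<times> ?S. (?h a (2 * g), trunc (2 * g) (?h a), ?h a (Suc (2 * g))) = a"
      using tr by auto
    show "\<forall>v\<in>fixed ?E. ?h (v (2 * g), trunc (2 * g) v, v (Suc (2 * g))) = v"
    proof
      fix v assume "v \<in> fixed ?E"
      then have "?E v = v" by (simp add: fixed_def)
      have "v i = 0" if "i > Suc (2 * g)" for i
      proof -
        have "v i = ?E v i" by (simp only: \<open>?E v = v\<close>)
        then show ?thesis using that by (simp add: extend_def)
      qed
      then show "?h (v (2 * g), trunc (2 * g) v, v (Suc (2 * g))) = v"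
        by (auto simp: trunc_def fun_eq_iff)
    qed
    show "?h ` (UNIV \<times> ?S) \<subseteq> fixed ?E"
    proof (rule image_subsetI)
      fix a :: "'a \<times> (nat \<Rightarrow> 'a) \<times> 'a" assume "a \<in> UNIV \<times> ?S"
      then obtain x y z where a: "a = (x, y, z)" and y: "y \<in> coords (2 * g)"
        and eq: "T y + scale z b = y" "sympl g (T y) b / q = c * z" "q * z = z" by auto
      have "T y i + z * b i = y i" for i using fun_cong[OF eq(1), of i] by (simp add: scale_def)
      then show "?h a \<in> fixed ?E"
        unfolding a fixed_def mem_Collect_eq extend_def Th[OF y] using eq(2,3) by auto
    qed
    show "(\<lambda>v. (v (2 * g), trunc (2 * g) v, v (Suc (2 * g)))) ` fixed ?E \<subseteq> UNIV \<times> ?S"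
    proof (rule image_subsetI)
      fix v assume "v \<in> fixed ?E"
      then have E: "?E v = v" by (simp add: fixed_def)
      have 1: "T v + scale (v (Suc (2 * g))) b = trunc (2 * g) v"
        using trunc_extend[OF T b, of c v] unfolding E by simp
      have 2: "sympl g (T v) b / q = c * v (Suc (2 * g))"
        using fun_cong[OF E, of "2 * g"] by (simp add: extend_def)
      have 3: "q * v (Suc (2 * g)) = v (Suc (2 * g))"
        using fun_cong[OF E, of "Suc (2 * g)"] by (simp add: extend_def)
      show "(v (2 * g), trunc (2 * g) v, v (Suc (2 * g))) \<in> UNIV \<times> ?S"
        using 1 2 3 by (auto simp: similD(6)[OF T])
    qed
  qed
  then show ?thesis by (simp add: bij_betw_same_card[symmetric] card_cartesian_product)
qed

section \<open>Counting fixed vectors\<close>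

definition subsp :: "(nat \<Rightarrow> 'a::comm_ring_1) set \<Rightarrow> bool" where
  "subsp K \<longleftrightarrow> 0 \<in> K \<and> (\<forall>u\<in>K. \<forall>v\<in>K. u + v \<in> K) \<and> (\<forall>u\<in>K. \<forall>v\<in>K. u - v \<in> K) \<and>
     (\<forall>c. \<forall>v\<in>K. scale c v \<in> K)"

lemma subsp_coords: "subsp (coords n)"
  by (simp add: subsp_def coords_add coords_diff coords_scale)

lemma subsp_fixed:
  assumes T: "T \<in> simil q g"
  shows "subsp (fixed T)"
  unfolding subsp_def fixed_def mem_Collect_eq similD(2-5)[OF T] by simp

lemma sum_if_subset:
  fixes x y :: real
  assumes "finite V" "P \<subseteq> V"
  shows "(\<Sum>b\<in>V. if b \<in> P then x else y) = card P * x + (real (card V) - card P) * y"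
proof -
  have "V \<inter> {b. b \<in> P} = P" "V \<inter> - {b. b \<in> P} = V - P" using assms by auto
  moreover have "real (card (V - P)) = real (card V) - card P"
    using assms by (simp add: card_Diff_subset finite_subset card_mono of_nat_diff)
  ultimately show ?thesis using assms(1) by (simp add: sum.If_cases)
qed

section \<open>Functionals and orthogonal complements\<close>

lemma card_functional_kernel:
  fixes \<phi> :: "(nat \<Rightarrow> 'a::{field,finite}) \<Rightarrow> 'a"
  assumes K: "subsp K" "finite K" and add: "\<And>u v. \<phi> (u + v) = \<phi> u + \<phi> v"
    and scale: "\<And>c v. \<phi> (scale c v) = c * \<phi> v" and y: "y \<in> K" "\<phi> y \<noteq> 0"
  shows "card K = CARD('a) * card {v \<in> K. \<phi> v = 0}"
proof -
  have "\<phi> ` K = UNIV"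
  proof (rule antisym, simp, rule subsetI)
    fix t
    have "scale (t / \<phi> y) y \<in> K" using K y by (simp add: subsp_def)
    moreover have "\<phi> (scale (t / \<phi> y) y) = t" using y by (simp add: scale)
    ultimately show "t \<in> \<phi> ` K" by (intro image_eqI) auto
  qed
  then show ?thesis
    using card_additive_image[of K \<phi>] K add by (simp add: subsp_def)
qed

definition perp :: "nat \<Rightarrow> (nat \<Rightarrow> 'a::comm_ring_1) set \<Rightarrow> (nat \<Rightarrow> 'a) set" where
  "perp g K = {b \<in> coords (2 * g). \<forall>y\<in>K. sympl g y b = 0}"

text \<open>The factor \<open>CARD('a)\<close> on the left avoids division of natural numbers and is
  exactly the one produced by the free coordinate in \<open>card_fixed_extend\<close>.\<close>

lemma card_annihilated:
  fixes K :: "(nat \<Rightarrow> 'a::{field,finite}) set"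
  assumes K: "subsp K" "finite K" and b: "b \<in> coords (2 * g)"
  shows "CARD('a) * card {y \<in> K. sympl g y b = 0} =
    (if b \<in> perp g K then CARD('a) * card K else card K)"
proof (cases "b \<in> perp g K")
  case True
  then have "{y \<in> K. sympl g y b = 0} = K" by (auto simp: perp_def)
  with True show ?thesis by simp
next
  case False
  then obtain y where "y \<in> K" "sympl g y b \<noteq> 0" using b by (auto simp: perp_def)
  with False show ?thesis
    using card_functional_kernel[OF K, of "\<lambda>y. sympl g y b" y] by (simp add: sympl_bilinear)
qed

lemma CARD_field_gt_1: "CARD('a::{zero_neq_one,finite}) > 1"
  using card_mono[of "UNIV :: 'a set" "{0, 1}"] by simp

text \<open>Count the orthogonal pairs in \<open>K \<times> coords (2 * g)\<close> in two ways.\<close>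

lemma card_perp:
  fixes K :: "(nat \<Rightarrow> 'a::{field,finite}) set"
  assumes K: "subsp K" "K \<subseteq> coords (2 * g)"
  shows "card (perp g K) * card K = CARD('a) ^ (2 * g)"
proof -
  let ?V = "coords (2 * g) :: (nat \<Rightarrow> 'a) set"
  let ?l = "real CARD('a)" and ?k = "real (card K)" and ?n = "real (card ?V)"
  let ?m = "real (card (perp g K))"
  have finK: "finite K" by (rule finite_subset[OF K(2) finite_coords])
  have zK: "0 \<in> K" using K(1) by (simp add: subsp_def)
  have pV: "perp g K \<subseteq> ?V" by (auto simp: perp_def)
  have "(\<Sum>b\<in>?V. \<Sum>y | y \<in> K \<and> sympl g y b = 0. ?l) = (\<Sum>b\<in>?V. if b \<in> perp g K then ?l * ?k else ?k)"
  proof (rule sum.cong[OF refl])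
    fix b assume b: "b \<in> ?V"
    show "(\<Sum>y | y \<in> K \<and> sympl g y b = 0. ?l) = (if b \<in> perp g K then ?l * ?k else ?k)"
      using arg_cong[OF card_annihilated[OF K(1) finK b], of real]
      by (cases "b \<in> perp g K") (simp_all add: mult.commute)
  qed
  also have "\<dots> = ?m * (?l * ?k) + (?n - ?m) * ?k"
    by (rule sum_if_subset[OF finite_coords pV])
  finally have left: "(\<Sum>b\<in>?V. \<Sum>y | y \<in> K \<and> sympl g y b = 0. ?l) = ?m * (?l * ?k) + (?n - ?m) * ?k" .
  have "(\<Sum>y\<in>K. \<Sum>b | b \<in> ?V \<and> sympl g y b = 0. ?l) = (\<Sum>y\<in>K. if y \<in> {0} then ?l * ?n else ?n)"
  proof (rule sum.cong[OF refl])
    fix y assume y: "y \<in> K"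
    show "(\<Sum>b | b \<in> ?V \<and> sympl g y b = 0. ?l) = (if y \<in> {0} then ?l * ?n else ?n)"
    proof (cases "y = 0")
      case False
      moreover have "y \<in> ?V" using y K(2) by blast
      ultimately obtain b where "b \<in> ?V" "sympl g y b \<noteq> 0"
        using sympl_nondegenerate[of y g] by auto
      then have "card ?V = CARD('a) * card {b \<in> ?V. sympl g y b = 0}"
        using card_functional_kernel[of ?V "sympl g y" b] by (simp add: sympl_bilinear subsp_coords)
      from arg_cong[OF this, of real] show ?thesis using False by simp
    qed simp
  qed
  also have "\<dots> = ?l * ?n + (?k - 1) * ?n"
    using sum_if_subset[OF finK, of "{0}" "?l * ?n" ?n] zK by simp
  finally have right: "(\<Sum>y\<in>K. \<Sum>b | b \<in> ?V \<and> sympl g y b = 0. ?l) = ?l * ?n + (?k - 1) * ?n" .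
  have "?m * (?l * ?k) + (?n - ?m) * ?k = ?l * ?n + (?k - 1) * ?n"
    unfolding left[symmetric] right[symmetric] by (rule sum.swap_restrict[OF finite_coords finK])
  then have "(?l - 1) * (?m * ?k) = (?l - 1) * ?n" by (simp add: algebra_simps)
  then have "?m * ?k = ?n" using CARD_field_gt_1[where 'a = 'a] by simp
  then have "real (card (perp g K) * card K) = real (card ?V)" by simp
  then have "card (perp g K) * card K = card ?V" by (simp only: of_nat_eq_iff)
  then show ?thesis by (simp add: card_coords)
qed

text \<open>If \<open>x\<close> is fixed by the isometry \<open>T\<close>, then pairing
  \<open>x\<close> with \<open>T y\<close> and with \<open>y\<close> gives the same value, so the
  image of T - 1 is orthogonal to \<open>fixed T\<close>. Both sides have the same size by
  rank-nullity and \<open>card_perp\<close>.\<close>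

lemma perp_fixed_eq_image:
  fixes T :: "(nat \<Rightarrow> 'a::{field,finite}) \<Rightarrow> nat \<Rightarrow> 'a"
  assumes T: "T \<in> simil 1 g"
  shows "perp g (fixed T) = (\<lambda>y. T y - y) ` coords (2 * g)"
proof (rule sym, rule card_subset_eq)
  let ?V = "coords (2 * g) :: (nat \<Rightarrow> 'a) set"
  let ?D = "\<lambda>y. T y - y"
  show "finite (perp g (fixed T))" by (simp add: perp_def)
  show "?D ` ?V \<subseteq> perp g (fixed T)"
  proof (rule image_subsetI)
    fix y assume y: "y \<in> ?V"
    have "sympl g x (T y - y) = 0" if "x \<in> fixed T" for x
      using that similD(9)[OF T, of x y] by (simp add: fixed_def sympl_bilinear)
    then show "?D y \<in> perp g (fixed T)"
      using y similD(8)[OF T] by (simp add: perp_def coords_diff)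
  qed
  have "{v \<in> ?V. ?D v = 0} = fixed T" using fixed_subset[OF T] by (auto simp: fixed_def)
  then have "card ?V = card (?D ` ?V) * card (fixed T)"
    using card_additive_image[of ?V ?D] by (simp add: coords_add coords_diff similD(2)[OF T])
  moreover have "card ?V = card (perp g (fixed T)) * card (fixed T)"
    using card_perp[OF subsp_fixed[OF T] fixed_subset[OF T]] by (simp add: card_coords)
  ultimately show "card (?D ` ?V) = card (perp g (fixed T))"
    using card_fixed_pos[OF T] by simp
qed

text \<open>Covers both situations in which a fixed vector has no component along f: multiplier
  other than 1, and multiplier 1 with \<open>b\<close> not orthogonal to \<open>fixed T\<close>.
  What is left is to count the vectors of \<open>fixed T\<close> orthogonal to
  \<open>b\<close>.\<close>

lemma card_fixed_extend_last_zero: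
  fixes q :: "'a::{field,finite}"
  assumes T: "T \<in> simil q g" and b: "b \<in> coords (2 * g)" and q: "q \<noteq> 0"
    and z: "\<And>y z. T y + scale z b = y \<Longrightarrow> q * z = z \<Longrightarrow> z = 0"
  shows "card (fixed (extend q g T b c)) =
    (if b \<in> perp g (fixed T) then CARD('a) * card (fixed T) else card (fixed T))"
proof -
  have s0: "scale 0 b = 0" by (simp add: scale_def fun_eq_iff)
  have "{(y, z). y \<in> coords (2 * g) \<and> T y + scale z b = y \<and> sympl g (T y) b / q = c * z \<and> q * z = z}
    = (\<lambda>y. (y, 0)) ` {y \<in> fixed T. sympl g y b = 0}" (is "?L = ?R")
  proof
    show "?L \<subseteq> ?R"
    proof clarify
      fix y z assume *: "T y + scale z b = y" "sympl g (T y) b / q = c * z" "q * z = z"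
      from z[OF *(1,3)] have z0: "z = 0" .
      then have "T y = y" using *(1) s0 by simp
      then show "(y, z) \<in> ?R" using *(2) z0 q by (auto simp: fixed_def)
    qed
    show "?R \<subseteq> ?L"
      using fixed_subset[OF T] s0 by (auto simp: fixed_def)
  qed
  then have "card (fixed (extend q g T b c)) = CARD('a) * card {y \<in> fixed T. sympl g y b = 0}"
    unfolding card_fixed_extend[OF T b] by (simp add: card_image inj_on_def)
  then show ?thesis using card_annihilated[OF subsp_fixed[OF T] finite_fixed[OF T] b] by simp
qed

lemma card_fixed_extend_neq_1:
  fixes q :: "'a::{field,finite}"
  assumes "T \<in> simil q g" "b \<in> coords (2 * g)" "q \<noteq> 0" "q \<noteq> 1"
  shows "card (fixed (extend q g T b c)) =
    (if b \<in> perp g (fixed T) then CARD('a) * card (fixed T) else card (fixed T))"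
  by (rule card_fixed_extend_last_zero) (use assms in auto)

lemma card_fixed_extend_1_not_perp:
  fixes b :: "nat \<Rightarrow> 'a::{field,finite}"
  assumes T: "T \<in> simil 1 g" and b: "b \<in> coords (2 * g)" "b \<notin> perp g (fixed T)"
  shows "card (fixed (extend 1 g T b c)) = card (fixed T)"
proof -
  obtain x where x: "T x = x" "sympl g x b \<noteq> 0" using b by (auto simp: perp_def fixed_def)
  \<comment> \<open>Pairing the equation with a fixed vector \<open>x\<close> eliminates
    \<open>y\<close>, since \<open>T\<close> is an isometry and \<open>T x = x\<close>.\<close>
  have "z = 0" if "T y + scale z b = y" for y z
  proof -
    have "sympl g x (T y) + z * sympl g x b = sympl g x y"
      using arg_cong[OF that, of "sympl g x"] by (simp add: sympl_bilinear)
    then show "z = 0" using similD(9)[OF T, of x y] x by simp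
  qed
  then show ?thesis using card_fixed_extend_last_zero[OF T b(1)] b(2) by simp
qed

text \<open>Here \<open>b = T y0 - y0\<close> for some \<open>y0\<close>, and the substitution
  \<open>x = y + scale z y0\<close> turns the middle equation into \<open>T x = x\<close>. As such
  an \<open>x\<close> is orthogonal to \<open>b\<close>, the row of e reduces to
  \<open>z * (c - c0) = 0\<close> with \<open>c0 = - sympl g y0 b\<close>. So \<open>z\<close> is
  free for a single value of \<open>c\<close> and zero otherwise.\<close>

lemma card_fixed_extend_1_perp:
  fixes b :: "nat \<Rightarrow> 'a::{field,finite}"
  assumes T: "T \<in> simil 1 g" and b: "b \<in> perp g (fixed T)"
  shows "\<exists>c0. \<forall>c. card (fixed (extend 1 g T b c)) =
    (if c = c0 then CARD('a) ^ 2 * card (fixed T) else CARD('a) * card (fixed T))"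
proof -
  have bV: "b \<in> coords (2 * g)" using b by (simp add: perp_def)
  obtain y0 where y0: "y0 \<in> coords (2 * g)" "T y0 - y0 = b"
    using b unfolding perp_fixed_eq_image[OF T] by auto
  let ?c0 = "- sympl g y0 b"
  have "card (fixed (extend 1 g T b c)) =
    (if c = ?c0 then CARD('a) ^ 2 * card (fixed T) else CARD('a) * card (fixed T))" for c
  proof -
    let ?S = "{(y, z). y \<in> coords (2 * g) \<and> T y + scale z b = y \<and> sympl g (T y) b / 1 = c * z \<and> 1 * z = z}"
    let ?Z = "{z. z * (c - ?c0) = 0}"
    have sc: "scale z b = scale z (T y0) - scale z y0" for z
      unfolding y0(2)[symmetric] by (simp add: scale_def fun_eq_iff algebra_simps)
    have key: "T y + scale z b = y \<longleftrightarrow> T (y + scale z y0) = y + scale z y0" for y z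
      unfolding sc similD(2,4)[OF T] by (simp add: algebra_simps)
    have form: "sympl g (T y) b = sympl g (y + scale z y0) b + z * ?c0" if "T y + scale z b = y" for y z
    proof -
      have "sympl g (T y) b = sympl g (T y + scale z b) b" by (simp add: sympl_bilinear)
      then show ?thesis using that by (simp add: sympl_bilinear)
    qed
    have orth: "sympl g x b = 0" if "T x = x" for x
      using b that by (simp add: perp_def fixed_def)
    have "bij_betw (\<lambda>(y, z). (y + scale z y0, z)) ?S (fixed T \<times> ?Z)"
    proof (rule bij_betw_byWitness[where f' = "\<lambda>(x, z). (x - scale z y0, z)"])
      show "(\<lambda>(y, z). (y + scale z y0, z)) ` ?S \<subseteq> fixed T \<times> ?Z"
      proof (rule image_subsetI)
        fix a assume "a \<in> ?S"
        then obtain y z where a: "a = (y, z)" and *: "T y + scale z b = y" "sympl g (T y) b / 1 = c * z"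
          by auto
        from *(1) have fx: "T (y + scale z y0) = y + scale z y0" unfolding key .
        have "z * c = - (z * sympl g y0 b)"
          using form[OF *(1)] orth[OF fx] *(2) by (simp add: mult.commute)
        then show "(\<lambda>(y, z). (y + scale z y0, z)) a \<in> fixed T \<times> ?Z"
          using fx by (simp add: a fixed_def distrib_left)
      qed
      show "(\<lambda>(x, z). (x - scale z y0, z)) ` (fixed T \<times> ?Z) \<subseteq> ?S"
      proof (rule image_subsetI)
        fix a assume "a \<in> fixed T \<times> ?Z"
        then obtain x z where a: "a = (x, z)" and x: "x \<in> fixed T" and z: "z * (c - ?c0) = 0" by auto
        let ?y = "x - scale z y0"
        have "T (?y + scale z y0) = ?y + scale z y0" using x by (simp add: fixed_def)
        then have *: "T ?y + scale z b = ?y" unfolding key .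
        have "sympl g (T ?y) b = z * ?c0" using form[OF *] orth[of x] x by (simp add: fixed_def)
        moreover have "?y \<in> coords (2 * g)"
          using fixed_subset[OF T] x y0(1) by (auto intro: coords_diff coords_scale)
        moreover have "z = 0 \<or> c = ?c0" using z by (simp only: mult_eq_0_iff right_minus_eq)
        then have "z * ?c0 = c * z" by auto
        ultimately show "(\<lambda>(x, z). (x - scale z y0, z)) a \<in> ?S"
          using * by (simp add: a)
      qed
    qed auto
    then have "card ?S = card (fixed T) * card ?Z"
      by (simp only: bij_betw_same_card card_cartesian_product)
    moreover have "card ?Z = (if c = ?c0 then CARD('a) else 1)"
    proof (cases "c = ?c0")
      case False
      then have "?Z = {0}" by (auto simp: eq_neg_iff_add_eq_0)
      then show ?thesis using False by simp
    qed simp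
    ultimately show ?thesis
      unfolding card_fixed_extend[OF T bV] by (simp add: power2_eq_square)
  qed
  then show ?thesis by blast
qed

section \<open>Sums over the stabilizer in terms of the induced similitude\<close>

lemma sum_stab_extend:
  fixes q :: "'a::{field,finite}"
  assumes q: "q \<noteq> 0"
  shows "(\<Sum>T\<in>stab q g. f (card (fixed T)) :: real) =
    (\<Sum>T\<in>simil q g. \<Sum>b\<in>coords (2 * g). \<Sum>c\<in>UNIV. f (card (fixed (extend q g T b c))))"
proof -
  have "(\<Sum>T\<in>stab q g. f (card (fixed T))) =
    (\<Sum>(T, b, c)\<in>simil q g \<times> coords (2 * g) \<times> UNIV. f (card (fixed (extend q g T b c))))"
    by (subst sum.reindex_bij_betw[OF bij_betw_extend[OF q], symmetric]) (simp add: case_prod_unfold)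
  then show ?thesis by (simp add: sum.cartesian_product)
qed

lemma card_stab:
  fixes q :: "'a::{field,finite}"
  assumes q: "q \<noteq> 0"
  shows "card (stab q g) = card (simil q g) * CARD('a) ^ Suc (2 * g)"
  using bij_betw_same_card[OF bij_betw_extend[OF q, of g]]
  by (simp add: card_cartesian_product card_coords ac_simps)

text \<open>By \<open>card_perp\<close>, the proportion of vectors \<open>b\<close> orthogonal to
  the fixed space is the reciprocal of the number of fixed vectors.\<close>

lemma sum_coords_perp:
  fixes T :: "(nat \<Rightarrow> 'a::{field,finite}) \<Rightarrow> nat \<Rightarrow> 'a"
  assumes T: "T \<in> simil q g"
  shows "(\<Sum>b\<in>coords (2 * g). if b \<in> perp g (fixed T) then x else y :: real) =
    real CARD('a) ^ (2 * g) * (x / card (fixed T) + (1 - 1 / card (fixed T)) * y)"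
proof -
  let ?V = "coords (2 * g) :: (nat \<Rightarrow> 'a) set"
  let ?P = "perp g (fixed T)"
  have pV: "?P \<subseteq> ?V" by (auto simp: perp_def)
  have P: "real (card ?P) = real CARD('a) ^ (2 * g) / card (fixed T)"
    using arg_cong[OF card_perp[OF subsp_fixed[OF T] fixed_subset[OF T]], of real] card_fixed_pos[OF T]
    by (simp add: field_simps)
  have "(\<Sum>b\<in>?V. if b \<in> ?P then x else y) = card ?P * x + (real (card ?V) - card ?P) * y"
    by (rule sum_if_subset[OF finite_coords pV])
  then show ?thesis by (simp add: P card_coords algebra_simps)
qed

lemma sum_stab_neq_1:
  fixes q :: "'a::{field,finite}"
  assumes q: "q \<noteq> 0" "q \<noteq> 1"
  defines "l \<equiv> CARD('a)"
  shows "(\<Sum>T\<in>stab q g. f (card (fixed T)) :: real) = real l ^ Suc (2 * g) *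
    (\<Sum>T\<in>simil q g. f (l * card (fixed T)) / card (fixed T) + (1 - 1 / card (fixed T)) * f (card (fixed T)))"
proof -
  have "(\<Sum>b\<in>coords (2 * g). \<Sum>c\<in>UNIV. f (card (fixed (extend q g T b c)))) =
    real l ^ Suc (2 * g) * (f (l * card (fixed T)) / card (fixed T) + (1 - 1 / card (fixed T)) * f (card (fixed T)))"
    if T: "T \<in> simil q g" for T
  proof -
    have "(\<Sum>b\<in>coords (2 * g). \<Sum>c\<in>UNIV. f (card (fixed (extend q g T b c)))) =
      (\<Sum>b\<in>coords (2 * g). if b \<in> perp g (fixed T) then l * f (l * card (fixed T)) else l * f (card (fixed T)))"
      by (rule sum.cong[OF refl]) (simp add: card_fixed_extend_neq_1[OF T _ q] l_def)
    then show ?thesis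
      unfolding sum_coords_perp[OF T] by (simp add: l_def[symmetric] algebra_simps)
  qed
  then show ?thesis by (simp add: sum_stab_extend[OF q(1)] sum_distrib_left)
qed

text \<open>For \<open>b\<close> orthogonal to the fixed space, exactly one of the \<open>l\<close>
  scalars \<open>c\<close> multiplies the count by \<open>l ^ 2\<close> and the others multiply it
  by \<open>l\<close>; hence the weights \<open>1 / l\<close> and \<open>1 - 1 / l\<close>.\<close>

lemma sum_stab_1:
  fixes f :: "nat \<Rightarrow> real" and g :: nat
  defines "l \<equiv> CARD('a::{field,finite})"
  shows "(\<Sum>T\<in>stab (1::'a) g. f (card (fixed T))) = real l ^ Suc (2 * g) *
    (\<Sum>T\<in>simil (1::'a) g. (f (l ^ 2 * card (fixed T)) / l + (1 - 1 / l) * f (l * card (fixed T))) / card (fixed T)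
      + (1 - 1 / card (fixed T)) * f (card (fixed T)))"
proof -
  have l: "l > 1" unfolding l_def by (rule CARD_field_gt_1)
  have "(\<Sum>b\<in>coords (2 * g). \<Sum>c\<in>UNIV. f (card (fixed (extend 1 g T b c)))) =
    real l ^ Suc (2 * g) * ((f (l ^ 2 * card (fixed T)) / l + (1 - 1 / l) * f (l * card (fixed T))) / card (fixed T)
      + (1 - 1 / card (fixed T)) * f (card (fixed T)))"
    if T: "T \<in> simil (1::'a) g" for T
  proof -
    have "(\<Sum>b\<in>coords (2 * g). \<Sum>c\<in>UNIV. f (card (fixed (extend 1 g T b c)))) =
      (\<Sum>b\<in>coords (2 * g). if b \<in> perp g (fixed T)
        then f (l ^ 2 * card (fixed T)) + (real l - 1) * f (l * card (fixed T)) else l * f (card (fixed T)))"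
    proof (rule sum.cong[OF refl])
      fix b :: "nat \<Rightarrow> 'a" assume b: "b \<in> coords (2 * g)"
      show "(\<Sum>c\<in>UNIV. f (card (fixed (extend 1 g T b c)))) = (if b \<in> perp g (fixed T)
        then f (l ^ 2 * card (fixed T)) + (real l - 1) * f (l * card (fixed T)) else l * f (card (fixed T)))"
      proof (cases "b \<in> perp g (fixed T)")
        case True
        then obtain c0 where c0: "\<And>c. card (fixed (extend 1 g T b c)) =
            (if c = c0 then l ^ 2 * card (fixed T) else l * card (fixed T))"
          using card_fixed_extend_1_perp[OF T] unfolding l_def by blast
        have "(\<Sum>c\<in>UNIV. f (card (fixed (extend 1 g T b c)))) =
            f (l ^ 2 * card (fixed T)) + (\<Sum>c\<in>UNIV - {c0}. f (l * card (fixed T)))"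
          unfolding c0 by (subst sum.remove[of _ c0]) auto
        then show ?thesis using True l by (simp add: card_Diff_singleton l_def of_nat_diff)
      next
        case False
        then show ?thesis using card_fixed_extend_1_not_perp[OF T b] by (simp add: l_def)
      qed
    qed
    then have "(\<Sum>b\<in>coords (2 * g). \<Sum>c\<in>UNIV. f (card (fixed (extend 1 g T b c)))) = real l ^ (2 * g) *
      ((f (l ^ 2 * card (fixed T)) + (real l - 1) * f (l * card (fixed T))) / card (fixed T) +
        l * ((1 - 1 / card (fixed T)) * f (card (fixed T))))"
      by (simp only: sum_coords_perp[OF T] l_def[symmetric] mult.left_commute[of _ "real l"])
    moreover have M: "real l ^ Suc (2 * g) * ((f (l ^ 2 * card (fixed T)) / l + (1 - 1 / l) * f (l * card (fixed T)))
        / card (fixed T) + y) = real l ^ (2 * g) *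
      ((f (l ^ 2 * card (fixed T)) + (real l - 1) * f (l * card (fixed T))) / card (fixed T) + l * y)" for y :: real
    proof -
      have "real l * (f (l ^ 2 * card (fixed T)) / l + (1 - 1 / l) * f (l * card (fixed T))) =
          f (l ^ 2 * card (fixed T)) + (real l - 1) * f (l * card (fixed T))"
        using l by (simp add: field_simps)
      from this[symmetric] show ?thesis by (simp only: power_Suc) (simp add: ring_distribs mult.assoc)
    qed
    ultimately show ?thesis by (simp only: M)
  qed
  then show ?thesis by (simp add: sum_stab_extend sum_distrib_left)
qed

section \<open>Identities for the factorial moments\<close>

text \<open>The series F(cX). Dilation respects products, and recursions between consecutive
  coefficients become functional equations relating a series to its dilate.\<close>

definition dilate :: "'a::comm_ring_1 \<Rightarrow> 'a fps \<Rightarrow> 'a fps" where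
  "dilate c F = Abs_fps (\<lambda>n. c ^ n * fps_nth F n)"

lemma dilate_mult: "dilate c (F * G) = dilate c F * dilate c G"
proof (rule fps_ext)
  fix n
  have "c ^ n * (fps_nth F i * fps_nth G (n - i)) = c ^ i * fps_nth F i * (c ^ (n - i) * fps_nth G (n - i))" if "i \<le> n" for i
  proof -
    have "c ^ n = c ^ i * c ^ (n - i)" using that by (simp flip: power_add)
    then show ?thesis by (simp add: mult_ac)
  qed
  then show "fps_nth (dilate c (F * G)) n = fps_nth (dilate c F * dilate c G) n"
    by (simp add: dilate_def fps_mult_nth sum_distrib_left)
qed

lemma dilate_linear: "dilate c (1 - fps_const a * fps_X) = 1 - fps_const (c * a) * fps_X"
  by (rule fps_ext) (simp add: dilate_def fps_X_def)

context
  fixes l :: real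
  assumes l: "l > 1"
begin

text \<open>The Gaussian factorial in base \<open>l\<close> multiplied by
  \<open>(l - 1) ^ k\<close>; \<open>qfact2\<close> is its analogue in base
  \<open>l ^ 2\<close>.\<close>

definition qfact :: "nat \<Rightarrow> real" where
  "qfact k = (\<Prod>j=1..k. l ^ j - 1)"

definition qfact2 :: "nat \<Rightarrow> real" where
  "qfact2 k = (\<Prod>j=1..k. l ^ (2 * j) - 1)"

text \<open>For a field with \<open>l\<close> elements and \<open>x = l ^ d\<close>, this is the
  number of linearly independent \<open>k\<close>-tuples in a space of dimension
  \<open>d\<close>.\<close>

definition fall :: "nat \<Rightarrow> real \<Rightarrow> real" where
  "fall k x = (\<Prod>i<k. x - l ^ i)"

text \<open>The coefficient of x^b in the product of 1 / (1 - x / l^(2i)) over i \<ge> 1, one of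
  Euler's exponential series in base l^(-2).\<close>

definition euler_coeff :: "nat \<Rightarrow> real" where
  "euler_coeff b = l ^ (b * (b - 1)) / qfact2 b"

lemma power_gt_1: "k > 0 \<Longrightarrow> l ^ k > 1"
  using l by simp

lemma qfact_simps [simp]: "qfact 0 = 1" "qfact (Suc k) = qfact k * (l ^ Suc k - 1)"
  by (simp_all add: qfact_def)

lemma qfact2_simps [simp]: "qfact2 0 = 1" "qfact2 (Suc k) = qfact2 k * (l ^ (2 * Suc k) - 1)"
  by (simp_all add: qfact2_def)

lemma qfact_pos: "qfact k > 0"
  unfolding qfact_def using power_gt_1 by (intro prod_pos) (auto simp del: One_nat_def)

lemma qfact2_pos: "qfact2 k > 0"
  unfolding qfact2_def using power_gt_1 by (intro prod_pos) (auto simp del: One_nat_def)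

lemma fall_simps: "fall 0 x = 1" "fall (Suc k) x = fall k x * (x - l ^ k)"
  by (simp_all add: fall_def)

lemma fall_Suc_shift: "fall (Suc k) x = (x - 1) * (\<Prod>i=1..k. x - l ^ i)"
  unfolding fall_def by (induction k) (simp_all add: mult.assoc)

lemma prod_dilate: "(\<Prod>i=1..k. l * x - l ^ i) = l ^ k * fall k x"
  by (induction k) (simp_all add: fall_simps algebra_simps)

lemma fall_Suc_dilate: "fall (Suc k) (l * x) = (l * x - 1) * (l ^ k * fall k x)"
  by (simp only: fall_Suc_shift prod_dilate)

text \<open>Both summands are multiples of \<open>fall k x / x\<close>, with factors
  \<open>l ^ k\<close> and \<open>x - l ^ k\<close> that add up to \<open>x\<close>. This
  cancellation is the reason for the choice of test function.\<close>

lemma moment_step_neq_1: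
  assumes "x \<noteq> 0"
  shows "(\<Prod>i=1..k. l * x - l ^ i) / x + (1 - 1 / x) * (\<Prod>i=1..k. x - l ^ i) = fall k x"
proof -
  have "(1 - 1 / x) * (\<Prod>i=1..k. x - l ^ i) = fall (Suc k) x / x"
    using assms by (simp only: fall_Suc_shift) (simp add: field_simps)
  also have "\<dots> = fall k x * (x - l ^ k) / x" by (simp only: fall_simps)
  finally show ?thesis using assms by (simp only: prod_dilate) (simp add: field_simps)
qed

text \<open>Compared with \<open>moment_step_neq_1\<close> there is an extra multiple of the
  difference quotient \<open>(fall k (l * x) - fall k x) / (l * x)\<close>. Like a derivative, it
  lowers the index of \<open>fall\<close> by one.\<close>

lemma moment_step_1:
  assumes "x \<noteq> 0"
  shows "((\<Prod>i=1..k. l ^ 2 * x - l ^ i) / l + (1 - 1 / l) * (\<Prod>i=1..k. l * x - l ^ i)) / x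
      + (1 - 1 / x) * (\<Prod>i=1..k. x - l ^ i)
    = fall k x + (case k of 0 \<Rightarrow> 0 | Suc j \<Rightarrow> l ^ j * (l ^ Suc j - 1) * fall j x)"
proof -
  have "(\<Prod>i=1..k. l ^ 2 * x - l ^ i) = l ^ k * fall k (l * x)"
    using prod_dilate[where x = "l * x"] by (simp add: power2_eq_square mult.assoc)
  moreover have "(1 - 1 / x) * (\<Prod>i=1..k. x - l ^ i) = fall k x - l ^ k * fall k x / x"
    using moment_step_neq_1[OF assms, of k] unfolding prod_dilate by linarith
  ultimately have "((\<Prod>i=1..k. l ^ 2 * x - l ^ i) / l + (1 - 1 / l) * (\<Prod>i=1..k. l * x - l ^ i)) / x
      + (1 - 1 / x) * (\<Prod>i=1..k. x - l ^ i)
    = fall k x + l ^ k * (fall k (l * x) - fall k x) / (l * x)"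
    using l assms by (simp only: prod_dilate) (simp add: field_simps)
  also have "l ^ k * (fall k (l * x) - fall k x) / (l * x) =
    (case k of 0 \<Rightarrow> 0 | Suc j \<Rightarrow> l ^ j * (l ^ Suc j - 1) * fall j x)"
  proof (cases k)
    case (Suc j)
    have "fall k (l * x) - fall k x = fall j x * x * (l ^ Suc j - 1)"
      unfolding Suc fall_Suc_dilate fall_simps(2)[where x = x] by (simp add: algebra_simps)
    then show ?thesis using Suc l assms by simp
  qed (simp add: fall_simps)
  finally show ?thesis .
qed

text \<open>A finite form of the q-binomial theorem. The right-hand side is 1 at x = 1 and vanishes
  at x = l, ..., l^m, so it detects a trivial fixed space among spaces of dimension at most
  \<open>m\<close>.\<close>

lemma sum_fall_telescope:
  "(\<Sum>k\<le>m. (- 1) ^ k * fall k x / qfact k) = (\<Prod>i=1..m. (l ^ i - x) / (l ^ i - 1))"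
proof (induction m)
  case (Suc m)
  have "(\<Prod>i=1..m. x - l ^ i) = (- 1) ^ m * (\<Prod>i=1..m. l ^ i - x)"
    by (induction m) (simp_all add: algebra_simps)
  then have "(- 1) ^ Suc m * fall (Suc m) x / qfact (Suc m) =
      - ((x - 1) * (\<Prod>i=1..m. l ^ i - x) / (qfact m * (l ^ Suc m - 1)))"
    by (simp only: fall_Suc_shift qfact_simps) (simp add: mult.left_commute flip: power_add)
  moreover have "(\<Prod>i=1..m. (l ^ i - x) / (l ^ i - 1)) = (\<Prod>i=1..m. l ^ i - x) / qfact m"
    by (simp add: qfact_def prod_dividef)
  ultimately show ?case
    using Suc qfact_pos[of m] power_gt_1[of "Suc m"]
    by (simp del: power_Suc) (simp add: field_simps del: power_Suc)
qed (simp add: fall_simps)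

lemma sum_fall_indicator:
  assumes "d \<le> m"
  shows "(\<Sum>k\<le>m. (- 1) ^ k * fall k (l ^ d) / qfact k) = (if d = 0 then 1 else 0)"
proof (cases "d = 0")
  case True
  have "(l ^ i - 1) / (l ^ i - 1) = 1" if "i \<in> {1..m}" for i
    using power_gt_1[of i] that by simp
  then show ?thesis using True by (simp add: sum_fall_telescope)
next
  case False
  then have "d \<in> {1..m}" using assms by simp
  then have "(\<Prod>i=1..m. (l ^ i - l ^ d) / (l ^ i - 1)) = 0" by (intro prod_zero) auto
  then show ?thesis using False by (simp add: sum_fall_telescope)
qed

text \<open>The coefficient of \<open>t\<^sup>r x\<^sup>k\<close> in \<open>\<Prod>\<^sub>i\<^sub>\<ge>\<^sub>1 (1 + t x / l\<^sup>i) / (1 - t x\<^sup>2 / l\<^sup>2\<^sup>i)\<close>, which solves the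
  functional equation for the generating function of the averages with multiplier 1.\<close>

definition moment_part :: "nat \<Rightarrow> nat \<Rightarrow> real" where
  "moment_part r k = (if r \<le> k \<and> k \<le> 2 * r then euler_coeff (k - r) / qfact (2 * r - k) else 0)"

lemma euler_coeff_Suc: "euler_coeff (Suc b) * (l ^ (2 * Suc b) - 1) = l ^ (2 * b) * euler_coeff b"
proof -
  have "Suc b * (Suc b - 1) = 2 * b + b * (b - 1)" by (cases b) auto
  then have "l ^ (Suc b * (Suc b - 1)) = l ^ (2 * b) * l ^ (b * (b - 1))" by (simp only: power_add)
  then show ?thesis
    using qfact2_pos[of b] power_gt_1[of "2 * Suc b"] unfolding euler_coeff_def qfact2_simps
    by (simp add: field_simps del: power_Suc mult_Suc mult_Suc_right)
qed

text \<open>Splits \<open>l ^ (a + 2 * b) - 1\<close> as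
  \<open>(l ^ a - 1) + l ^ a * (l ^ (2 * b) - 1)\<close>. The first part lowers the index of
  \<open>qfact\<close>, the second that of \<open>euler_coeff\<close>.\<close>

lemma euler_coeff_qfact_step:
  "euler_coeff b / qfact a * (l ^ (a + 2 * b) - 1) =
    (case a of 0 \<Rightarrow> 0 | Suc a' \<Rightarrow> euler_coeff b / qfact a') +
    (case b of 0 \<Rightarrow> 0 | Suc b' \<Rightarrow> l ^ (a + 2 * b') * (euler_coeff b' / qfact a))"
proof -
  have 1: "euler_coeff b / qfact a * (l ^ a - 1) = (case a of 0 \<Rightarrow> 0 | Suc a' \<Rightarrow> euler_coeff b / qfact a')"
  proof (cases a)
    case (Suc a')
    then show ?thesis
      using power_gt_1[of a] by (simp del: power_Suc)
  qed simp
  have 2: "euler_coeff b / qfact a * (l ^ a * (l ^ (2 * b) - 1)) =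
      (case b of 0 \<Rightarrow> 0 | Suc b' \<Rightarrow> l ^ (a + 2 * b') * (euler_coeff b' / qfact a))"
  proof (cases b)
    case (Suc b')
    have "euler_coeff b / qfact a * (l ^ a * (l ^ (2 * b) - 1)) =
        l ^ a * (euler_coeff (Suc b') * (l ^ (2 * Suc b') - 1)) / qfact a" by (simp add: Suc)
    then show ?thesis unfolding euler_coeff_Suc by (simp add: Suc power_add)
  qed simp
  have "l ^ (a + 2 * b) - 1 = (l ^ a - 1) + l ^ a * (l ^ (2 * b) - 1)"
    by (simp add: power_add algebra_simps)
  then show ?thesis using 1 2 by (simp only: distrib_left)
qed

text \<open>Let F(x) be the product in t and x whose coefficients are \<open>moment_part\<close>.
  Shifting the index in both products gives F(lx) (1 - t x^2) = F(x) (1 + t x), that is, F(lx) -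
  F(x) = t x F(x) + t x^2 F(lx); the lemma compares coefficients.\<close>

lemma moment_part_Suc:
  "moment_part (Suc r) (Suc k) * (l ^ Suc k - 1) =
    moment_part r k + (case k of 0 \<Rightarrow> 0 | Suc j \<Rightarrow> l ^ j * moment_part r j)"
proof (cases "r \<le> k \<and> k \<le> 2 * r + 1")
  case True
  \<comment> \<open>The numerator of the product contributes t^a x^a and the denominator t^b x^(2b);
    the two equations for the exponents of t and x determine \<open>a\<close> and
    \<open>b\<close>.\<close>
  define a b where "a = 2 * r + 1 - k" and "b = k - r"
  have k: "Suc k = a + 2 * b" and r: "Suc r = a + b" using True by (auto simp: a_def b_def)
  have "moment_part (Suc r) (Suc k) = euler_coeff b / qfact a"
    using True by (simp add: moment_part_def a_def b_def)
  moreover have "moment_part r k = (case a of 0 \<Rightarrow> 0 | Suc a' \<Rightarrow> euler_coeff b / qfact a')"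
    using True by (cases "k = 2 * r + 1") (auto simp: moment_part_def a_def b_def Suc_diff_le)
  moreover have "(case k of 0 \<Rightarrow> 0 | Suc j \<Rightarrow> l ^ j * moment_part r j) =
      (case b of 0 \<Rightarrow> 0 | Suc b' \<Rightarrow> l ^ (a + 2 * b') * (euler_coeff b' / qfact a))"
  proof (cases b)
    case 0
    then have "k = r" using True by (simp add: b_def)
    then show ?thesis using 0 by (cases r) (simp_all add: moment_part_def)
  next
    case (Suc b')
    then obtain j where j: "k = Suc j" using True by (cases k) (auto simp: b_def)
    have "j = a + 2 * b'" using j k Suc by simp
    moreover have "moment_part r j = euler_coeff b' / qfact a"
    proof -
      have "r \<le> j" "j \<le> 2 * r" "j - r = b'" "2 * r - j = a"
        using True Suc j by (auto simp: a_def b_def)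
      then show ?thesis by (simp add: moment_part_def)
    qed
    ultimately show ?thesis by (simp add: j Suc)
  qed
  ultimately show ?thesis using euler_coeff_qfact_step[of b a] by (simp only: k)
qed (auto simp: moment_part_def split: nat.split)

text \<open>Here \<open>A\<close> is the product of 1 - x / l^i and \<open>C\<close> the product of
  1 / (1 - x / l^(2i)), so that in \<open>A * C\<close> only the factors of \<open>A\<close> with
  odd i survive, again an Euler product in base l^(-2). Infinite products are avoided: the equation
  for \<open>A * C\<close> under dilation by \<open>l ^ 2\<close> and the constant coefficient 1
  determine all coefficients, as l^(2n) is not 1 for n > 0.\<close>

lemma sum_euler:
  "(\<Sum>a\<le>r. (- 1) ^ a / qfact a * euler_coeff (r - a)) = (- l) ^ r / qfact2 r"
proof -
  define A where "A = Abs_fps (\<lambda>n. (- 1) ^ n / qfact n)"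
  define C where "C = Abs_fps euler_coeff"
  have A1: "dilate l A = (1 - fps_const 1 * fps_X) * A"
  proof (rule fps_ext)
    fix n show "fps_nth (dilate l A) n = fps_nth ((1 - fps_const 1 * fps_X) * A) n"
    proof (cases n)
      case (Suc m)
      then show ?thesis
        using qfact_pos[of m] power_gt_1[of n]
        by (simp add: dilate_def A_def left_diff_distrib) (simp add: field_simps)
    qed (simp add: dilate_def A_def left_diff_distrib)
  qed
  have A2: "dilate (l ^ 2) A = (1 - fps_const l * fps_X) * ((1 - fps_X) * A)"
  proof -
    have "dilate (l ^ 2) A = dilate l (dilate l A)"
      by (simp add: dilate_def power2_eq_square power_mult_distrib mult.assoc)
    also have "\<dots> = dilate l (1 - fps_const 1 * fps_X) * dilate l A"
      by (simp only: A1 dilate_mult)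
    finally show ?thesis unfolding dilate_linear A1 by simp
  qed
  have C2: "(1 - fps_X) * dilate (l ^ 2) C = C"
  proof (rule fps_ext)
    fix n show "fps_nth ((1 - fps_X) * dilate (l ^ 2) C) n = fps_nth C n"
    proof (cases n)
      case (Suc m)
      then show ?thesis
        using euler_coeff_Suc[of m]
        by (simp add: dilate_def C_def left_diff_distrib power_mult[symmetric] algebra_simps del: power_Suc)
    qed (simp add: dilate_def C_def left_diff_distrib)
  qed
  have "dilate (l ^ 2) (A * C) = (1 - fps_const l * fps_X) * A * ((1 - fps_X) * dilate (l ^ 2) C)"
    by (simp only: dilate_mult A2 mult_ac)
  then have W: "dilate (l ^ 2) (A * C) = A * C - fps_const l * (fps_X * (A * C))"
    unfolding C2 by (simp add: algebra_simps)
  have "fps_nth (A * C) r = (- l) ^ r / qfact2 r"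
  proof (induction r)
    case 0
    show ?case by (simp add: A_def C_def euler_coeff_def)
  next
    case (Suc r)
    have "(l ^ 2) ^ Suc r * fps_nth (A * C) (Suc r) = fps_nth (A * C) (Suc r) - l * fps_nth (A * C) r"
      using arg_cong[OF W, of "\<lambda>F. fps_nth F (Suc r)"] by (simp add: dilate_def del: power_Suc)
    moreover have "(l ^ 2) ^ Suc r = l ^ (2 * Suc r)" by (simp only: power_mult)
    ultimately have "(l ^ (2 * Suc r) - 1) * fps_nth (A * C) (Suc r) = - l * ((- l) ^ r / qfact2 r)"
      unfolding Suc by (simp only: left_diff_distrib)
    then show ?case
      using power_gt_1[of "2 * Suc r"] qfact2_pos[of r] unfolding qfact2_simps
      by (simp add: field_simps del: mult_Suc_right)
  qed
  then show ?thesis by (simp add: fps_mult_nth A_def C_def atMost_atLeast0)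
qed

text \<open>This is the generating product at x = -1, which becomes \<open>A * C\<close> of
  \<open>sum_euler\<close>. The bound \<open>2 * g\<close> covers all \<open>k\<close> from
  \<open>r\<close> to \<open>2 * r\<close>, where \<open>moment_part r k\<close> is
  supported.\<close>

lemma alternating_sum_moment_part:
  assumes "r \<le> g"
  shows "(\<Sum>k\<le>2 * g. (- 1) ^ k * moment_part r k) = (- l) ^ r / qfact2 r"
proof -
  have "(\<Sum>k\<le>2 * g. (- 1) ^ k * moment_part r k) = (\<Sum>k\<in>{r..2 * r}. (- 1) ^ k * moment_part r k)"
    using assms by (intro sum.mono_neutral_right) (auto simp: moment_part_def)
  also have "\<dots> = (\<Sum>a\<le>r. (- 1) ^ (2 * r - a) * moment_part r (2 * r - a))"
    by (rule sum.reindex_bij_witness[where i = "\<lambda>a. 2 * r - a" and j = "\<lambda>k. 2 * r - k"]) auto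
  also have "\<dots> = (\<Sum>a\<le>r. (- 1) ^ a / qfact a * euler_coeff (r - a))"
  proof (rule sum.cong[OF refl])
    fix a assume "a \<in> {..r}"
    then have "(- 1 :: real) ^ (2 * r - a) = (- 1) ^ a" "r \<le> 2 * r - a" "2 * r - a - r = r - a"
      "2 * r - (2 * r - a) = a" by (auto simp: minus_one_power_iff)
    then show "(- 1) ^ (2 * r - a) * moment_part r (2 * r - a) = (- 1) ^ a / qfact a * euler_coeff (r - a)"
      by (simp add: moment_part_def)
  qed
  finally show ?thesis by (simp only: sum_euler)
qed

end

section \<open>Averages over similitudes\<close>

lemma simil_0: "simil q 0 = {\<lambda>_. 0}"
proof
  show "simil q 0 \<subseteq> {\<lambda>_. 0}"
  proof
    fix T assume T: "T \<in> simil q 0"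
    have "T v = 0" for v
      using similD(8)[OF T, of v] by (simp add: coords_def fun_eq_iff)
    then show "T \<in> {\<lambda>_. 0}" by (simp add: fun_eq_iff)
  qed
  show "{\<lambda>_. 0} \<subseteq> simil q 0"
    by (simp add: simil_def lin_def sympl_def) (simp add: trunc_def scale_def fun_eq_iff)
qed

lemma fixed_zero: "fixed (\<lambda>_. 0) = {0}"
  by (auto simp: fixed_def)

lemma card_simil_pos:
  fixes q :: "'a::{field,finite}"
  assumes q: "q \<noteq> 0"
  shows "card (simil q g) > 0"
proof (induction g)
  case (Suc g)
  have "real CARD('a) ^ (2 * Suc g) > 1"
    using CARD_field_gt_1[where 'a = 'a] by (intro one_less_power) auto
  then have "real (card (simil q (Suc g))) > 0"
    unfolding card_simil_Suc[OF q] card_stab[OF q] using Suc CARD_field_gt_1[where 'a = 'a] by simp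
  then show ?case by simp
qed (simp add: simil_0)

text \<open>Avoids a theory of dimension: a nontrivial fixed space can be moved so as to contain e,
  and the block form multiplies the count for rank \<open>g\<close> by a power of
  \<open>CARD('a)\<close> with exponent at most 2. The bound on \<open>d\<close> comes out of the
  same induction.\<close>

lemma card_fixed_power:
  fixes q :: "'a::{field,finite}"
  assumes q: "q \<noteq> 0"
  shows "T \<in> simil q g \<Longrightarrow> \<exists>d\<le>2 * g. card (fixed T) = CARD('a) ^ d"
proof (induction g arbitrary: T)
  case 0
  then have "T = (\<lambda>_. 0)" unfolding simil_0 by simp
  then have "card (fixed T) = 1" by (simp only: fixed_zero) simp
  then show ?case by simp
next
  case (Suc g)
  show ?case
  proof (cases "card (fixed T) = 1")
    case True
    then show ?thesis by (intro exI[of _ 0]) simp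
  next
    case False
    then obtain T' where T': "T' \<in> stab q g" "card (fixed T') = card (fixed T)"
      using ex_stab_card_fixed[OF Suc.prems] by auto
    have "T' \<in> (\<lambda>(T, b, c). extend q g T b c) ` (simil q g \<times> coords (2 * g) \<times> UNIV)"
      using T'(1) unfolding bij_betw_imp_surj_on[OF bij_betw_extend[OF q]] .
    then obtain S b c where S: "S \<in> simil q g" "b \<in> coords (2 * g)" "T' = extend q g S b c"
      by auto
    obtain d where d: "d \<le> 2 * g" "card (fixed S) = CARD('a) ^ d" using Suc.IH[OF S(1)] by auto
    have "\<exists>e\<le>2. card (fixed T') = CARD('a) ^ e * card (fixed S)"
    proof (cases "q = 1")
      case False
      have "card (fixed T') = CARD('a) ^ (if b \<in> perp g (fixed S) then 1 else 0) * card (fixed S)"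
        using card_fixed_extend_neq_1[OF S(1,2) q False, of c] by (simp add: S(3))
      then show ?thesis by (intro exI[of _ "if b \<in> perp g (fixed S) then 1 else 0"] conjI) simp_all
    next
      case True
      show ?thesis
      proof (cases "b \<in> perp g (fixed S)")
        case perp: True
        obtain c0 where "card (fixed T') =
            (if c = c0 then CARD('a) ^ 2 * card (fixed S) else CARD('a) * card (fixed S))"
          using card_fixed_extend_1_perp[of S g b] S perp True by auto
        then have "card (fixed T') = CARD('a) ^ (if c = c0 then 2 else 1) * card (fixed S)" by simp
        then show ?thesis by (intro exI[of _ "if c = c0 then 2 else 1"] conjI) simp_all
      next
        case False
        then show ?thesis
          using card_fixed_extend_1_not_perp[of S g b c] S True by (intro exI[of _ 0]) simp
      qed
    qed
    then obtain e where "e \<le> 2" "card (fixed T) = CARD('a) ^ (e + d)"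
      using T'(2) d(2) by (auto simp: power_add)
    then show ?thesis using d(1) by (intro exI[of _ "e + d"]) simp
  qed
qed

section \<open>Averages and their recursion in the rank\<close>

definition avg :: "'a::{field,finite} \<Rightarrow> nat \<Rightarrow> (nat \<Rightarrow> real) \<Rightarrow> real" where
  "avg q g f = (\<Sum>T\<in>simil q g. f (card (fixed T))) / card (simil q g)"

lemma avg_cong:
  fixes q :: "'a::{field,finite}"
  assumes "\<And>T. T \<in> simil q g \<Longrightarrow> f (card (fixed T)) = h (card (fixed T))"
  shows "avg q g f = avg q g h"
  using assms by (simp add: avg_def cong: sum.cong)

lemma avg_0: "avg q 0 f = f 1"
  by (simp add: avg_def simil_0 fixed_zero)

lemma avg_const:
  fixes q :: "'a::{field,finite}"
  assumes "q \<noteq> 0"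
  shows "avg q g (\<lambda>_. c) = c"
proof -
  have "real (card (simil q g)) \<noteq> 0" using card_simil_pos[OF assms, of g] by linarith
  then show ?thesis unfolding avg_def sum_constant by (rule nonzero_mult_div_cancel_left)
qed

lemma avg_add: "avg q g (\<lambda>n. f n + h n) = avg q g f + avg q g h"
  by (simp add: avg_def sum.distrib add_divide_distrib)

lemma avg_scale: "avg q g (\<lambda>n. c * f n) = c * avg q g f"
  by (simp add: avg_def sum_distrib_left)

text \<open>The number of nonzero vectors occurs in the weighted sum and in the number of
  similitudes, and cancels.\<close>

lemma avg_weighted:
  fixes q :: "'a::{field,finite}"
  assumes q: "q \<noteq> 0"
  shows "avg q (Suc g) (\<lambda>n. (real n - 1) * f n) =
    (\<Sum>T\<in>stab q g. f (card (fixed T))) / card (stab q g)"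
proof -
  have "real CARD('a) ^ (2 * Suc g) > 1"
    using CARD_field_gt_1[where 'a = 'a] by (intro one_less_power) auto
  then have "real CARD('a) ^ (2 * Suc g) - 1 \<noteq> 0" by simp
  then show ?thesis
    unfolding avg_def sum_fixed_weighted card_simil_Suc[OF q] by (rule mult_divide_mult_cancel_left)
qed

lemma avg_Suc_neq_1:
  fixes q :: "'a::{field,finite}"
  assumes q: "q \<noteq> 0" "q \<noteq> 1"
  shows "avg q (Suc g) (\<lambda>n. (real n - 1) * f n) =
    avg q g (\<lambda>n. f (CARD('a) * n) / n + (1 - 1 / n) * f n)"
proof -
  have nz: "real CARD('a) ^ Suc (2 * g) \<noteq> 0" using CARD_field_gt_1[where 'a = 'a] by simp
  show ?thesis
    unfolding avg_weighted[OF q(1)] sum_stab_neq_1[OF q] card_stab[OF q(1)]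
    unfolding avg_def of_nat_mult of_nat_power by (simp only: mult.commute[of _ "_ ^ Suc _"] mult_divide_mult_cancel_left[OF nz])
qed

lemma avg_Suc_1:
  shows "avg (1 :: 'a::{field,finite}) (Suc g) (\<lambda>n. (real n - 1) * f n) =
    avg (1 :: 'a) g (\<lambda>n. (f (CARD('a) ^ 2 * n) / CARD('a) + (1 - 1 / CARD('a)) * f (CARD('a) * n)) / n
      + (1 - 1 / n) * f n)"
proof -
  have nz: "real CARD('a) ^ Suc (2 * g) \<noteq> 0" using CARD_field_gt_1[where 'a = 'a] by simp
  show ?thesis
    unfolding avg_weighted[OF one_neq_zero] sum_stab_1 card_stab[OF one_neq_zero]
    unfolding avg_def of_nat_mult of_nat_power by (simp only: mult.commute[of _ "_ ^ Suc _"] mult_divide_mult_cancel_left[OF nz])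
qed

text \<open>The recursion lowers \<open>g\<close> and \<open>k\<close> together without any
  coefficient, so the value depends on which of them reaches 0 first: \<open>fall 0\<close> is 1,
  while for \<open>g = 0\<close> there is one fixed vector and \<open>fall k 1\<close> vanishes for
  \<open>k > 0\<close>.\<close>

lemma avg_fall_neq_1:
  fixes q :: "'a::{field,finite}"
  assumes q: "q \<noteq> 0" "q \<noteq> 1"
  defines "l \<equiv> real CARD('a)"
  shows "avg q g (\<lambda>n. fall l k (real n)) = (if k \<le> g then 1 else 0)"
proof -
  have l: "l > 1" using CARD_field_gt_1[where 'a = 'a] by (simp add: l_def)
  note simps = fall_simps[OF l] fall_Suc_shift[OF l]
  show ?thesis
  proof (induction g arbitrary: k)
    case 0
    then show ?case by (cases k) (simp_all add: avg_0 simps(1,3))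
  next
    case (Suc g)
    show ?case
    proof (cases k)
      case 0
      then show ?thesis using q by (simp add: simps(1) avg_const)
    next
      case k: (Suc j)
      have "avg q (Suc g) (\<lambda>n. fall l k (real n)) =
          avg q g (\<lambda>n. (\<Prod>i=1..j. l * real n - l ^ i) / n + (1 - 1 / n) * (\<Prod>i=1..j. real n - l ^ i))"
        unfolding k fall_Suc_shift[OF l]
        using avg_Suc_neq_1[OF q, of g "\<lambda>n. \<Prod>i=1..j. real n - l ^ i"] by (simp add: l_def)
      also have "\<dots> = avg q g (\<lambda>n. fall l j (real n))"
        by (rule avg_cong, rule moment_step_neq_1[OF l], drule card_fixed_pos, linarith)
      finally show ?thesis using Suc[of j] by (simp add: k)
    qed
  qed
qed

text \<open>The sum over \<open>r\<close> corresponds to a factor 1 / (1 - t) of the generating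
  function in \<open>g\<close>. It accounts for the average with \<open>k = 0\<close> being 1 for
  every \<open>g\<close>, which the recursion leaves open.\<close>

lemma avg_fall_1:
  fixes g k :: nat
  defines "l \<equiv> real CARD('a::{field,finite})"
  shows "avg (1 :: 'a) g (\<lambda>n. fall l k (real n)) = qfact l k * (\<Sum>r\<le>g. moment_part l r k)"
proof -
  have l: "l > 1" using CARD_field_gt_1[where 'a = 'a] by (simp add: l_def)
  note simps = fall_simps[OF l] fall_Suc_shift[OF l]
  show ?thesis
  proof (induction g arbitrary: k)
    case 0
    then show ?case
      by (cases k) (simp_all add: avg_0 simps(1,3) moment_part_def[OF l] euler_coeff_def[OF l] qfact_simps[OF l] qfact2_simps[OF l])
  next
    case (Suc g)
    show ?case
    proof (cases k)
      case 0
      have "(\<Sum>r\<le>Suc g. moment_part l r 0) = (\<Sum>r\<in>{0}. moment_part l r 0)"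
        by (intro sum.mono_neutral_right) (auto simp: moment_part_def[OF l])
      then show ?thesis using 0 by (simp add: simps(1) avg_const moment_part_def[OF l] euler_coeff_def[OF l] qfact_simps[OF l] qfact2_simps[OF l])
    next
      case k: (Suc j)
      let ?c = "\<lambda>i. l ^ i * (l ^ Suc i - 1)"
      have "avg (1 :: 'a) (Suc g) (\<lambda>n. fall l k (real n)) =
          avg (1 :: 'a) g (\<lambda>n. ((\<Prod>i=1..j. l ^ 2 * real n - l ^ i) / l
            + (1 - 1 / l) * (\<Prod>i=1..j. l * real n - l ^ i)) / n + (1 - 1 / n) * (\<Prod>i=1..j. real n - l ^ i))"
        unfolding k fall_Suc_shift[OF l]
        using avg_Suc_1[where 'a = 'a, of g "\<lambda>n. \<Prod>i=1..j. real n - l ^ i"] by (simp add: l_def)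
      also have "\<dots> = avg (1 :: 'a) g (\<lambda>n. fall l j (real n) +
          (case j of 0 \<Rightarrow> 0 | Suc i \<Rightarrow> ?c i * fall l i (real n)))"
        by (rule avg_cong, rule moment_step_1[OF l], drule card_fixed_pos, linarith)
      also have "\<dots> = avg (1 :: 'a) g (\<lambda>n. fall l j (real n)) +
          (case j of 0 \<Rightarrow> 0 | Suc i \<Rightarrow> ?c i * avg (1 :: 'a) g (\<lambda>n. fall l i (real n)))"
        by (cases j) (simp_all add: avg_add avg_scale del: power_Suc)
      also have "\<dots> = qfact l j * (\<Sum>r\<le>g. moment_part l r j +
          (case j of 0 \<Rightarrow> 0 | Suc i \<Rightarrow> l ^ i * moment_part l r i))"
        unfolding Suc by (cases j) (simp_all add: qfact_simps[OF l] sum.distrib sum_distrib_left algebra_simps del: power_Suc)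
      also have "\<dots> = qfact l j * (\<Sum>r\<le>g. moment_part l (Suc r) k * (l ^ k - 1))"
        unfolding k moment_part_Suc[OF l] by simp
      also have "\<dots> = qfact l k * (\<Sum>r\<le>g. moment_part l (Suc r) k)"
        by (simp add: k qfact_simps[OF l] del: power_Suc flip: sum_distrib_right)
      \<comment> \<open>The added term with \<open>r = 0\<close> vanishes because
        \<open>k > 0\<close>.\<close>
      also have "(\<Sum>r\<le>g. moment_part l (Suc r) k) = (\<Sum>r\<le>Suc g. moment_part l r k)"
        unfolding sum.atMost_Suc_shift by (simp add: k moment_part_def[OF l])
      finally show ?thesis .
    qed
  qed
qed

text \<open>Fixed spaces have dimension at most \<open>2 * g\<close>, so
  \<open>sum_fall_indicator\<close> with this bound represents the indicator of N = 1 for every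
  similitude. Averaging and passing to the complement give the claim.\<close>

lemma proportion_eq_moment_sum:
  fixes q :: "'a::{field,finite}"
  assumes q: "q \<noteq> 0"
  defines "l \<equiv> real CARD('a)"
  shows "real (card {T \<in> simil q g. card (fixed T) \<noteq> 1}) / card (simil q g) =
    1 - (\<Sum>k\<le>2 * g. (- 1) ^ k * avg q g (\<lambda>n. fall l k (real n)) / qfact l k)"
proof -
  have l: "l > 1" using CARD_field_gt_1[where 'a = 'a] by (simp add: l_def)
  have "(\<Sum>k\<le>2 * g. (- 1) ^ k * avg q g (\<lambda>n. fall l k (real n)) / qfact l k) =
      (\<Sum>k\<le>2 * g. \<Sum>T\<in>simil q g. (- 1) ^ k * fall l k (card (fixed T)) / qfact l k) / card (simil q g)"
    by (simp add: avg_def sum_divide_distrib sum_distrib_left mult_ac)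
  also have "(\<Sum>k\<le>2 * g. \<Sum>T\<in>simil q g. (- 1) ^ k * fall l k (card (fixed T)) / qfact l k) =
      (\<Sum>T\<in>simil q g. \<Sum>k\<le>2 * g. (- 1) ^ k * fall l k (card (fixed T)) / qfact l k)"
    by (rule sum.swap)
  also have "\<dots> = (\<Sum>T\<in>simil q g. if card (fixed T) = 1 then 1 else 0)"
  proof (rule sum.cong[OF refl])
    fix T assume "T \<in> simil q g"
    then obtain d where d: "d \<le> 2 * g" "card (fixed T) = CARD('a) ^ d" using card_fixed_power[OF q] by blast
    have "card (fixed T) = 1 \<longleftrightarrow> d = 0" using d CARD_field_gt_1[where 'a = 'a] by simp
    then show "(\<Sum>k\<le>2 * g. (- 1) ^ k * fall l k (card (fixed T)) / qfact l k) =
        (if card (fixed T) = 1 then 1 else 0)"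
      using sum_fall_indicator[OF l d(1)] d(2) by (simp add: l_def)
  qed
  also have "\<dots> = real (card {T \<in> simil q g. card (fixed T) = 1})"
    by (simp add: sum.If_cases Collect_conj_eq[symmetric] Int_def)
  also have "\<dots> = real (card (simil q g)) - real (card {T \<in> simil q g. card (fixed T) \<noteq> 1})"
  proof -
    have "{T \<in> simil q g. card (fixed T) = 1} = simil q g - {T \<in> simil q g. card (fixed T) \<noteq> 1}" by auto
    moreover have "card {T \<in> simil q g. card (fixed T) \<noteq> 1} \<le> card (simil q g)"
      by (rule card_mono) auto
    ultimately show ?thesis by (simp add: card_Diff_subset of_nat_diff)
  qed
  finally have eq: "(\<Sum>k\<le>2 * g. (- 1) ^ k * avg q g (\<lambda>n. fall l k (real n)) / qfact l k) =
    (real (card (simil q g)) - real (card {T \<in> simil q g. card (fixed T) \<noteq> 1})) / card (simil q g)" .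
  have nz: "real (card (simil q g)) \<noteq> 0" using card_simil_pos[OF q, of g] by linarith
  show ?thesis unfolding eq diff_divide_distrib divide_self[OF nz] by linarith
qed

section \<open>Closed forms of the proportion\<close>

lemma prod_inverse_one_minus:
  fixes f :: "nat \<Rightarrow> real"
  shows "(\<Prod>j=1..k. inverse (1 - f j)) = (- 1) ^ k / (\<Prod>j=1..k. f j - 1)"
proof (induction k)
  case (Suc k)
  have "inverse (1 - f (Suc k)) = - inverse (f (Suc k) - 1)"
    by (simp flip: inverse_minus_eq)
  then show ?case using Suc by (simp add: divide_inverse)
qed simp

lemma proportion_neq_1:
  fixes q :: "'a::{field,finite}"
  assumes q: "q \<noteq> 0" "q \<noteq> 1"
  shows "real (card {T \<in> simil q g. card (fixed T) \<noteq> 1}) / card (simil q g) =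
    - (\<Sum>r=1..g. \<Prod>j=1..r. inverse (1 - real CARD('a) ^ j))"
proof -
  define l where "l = real CARD('a)"
  have l: "l > 1" using CARD_field_gt_1[where 'a = 'a] by (simp add: l_def)
  have "(\<Sum>k\<le>2 * g. (- 1) ^ k * avg q g (\<lambda>n. fall l k (real n)) / qfact l k) =
      (\<Sum>k\<le>g. (- 1) ^ k / qfact l k)"
    unfolding l_def avg_fall_neq_1[OF q] by (rule sum.mono_neutral_cong_right) auto
  also have "\<dots> = (\<Sum>k\<le>g. \<Prod>j=1..k. inverse (1 - l ^ j))"
    by (simp only: qfact_def[OF l] prod_inverse_one_minus)
  \<comment> \<open>The term for \<open>k = 0\<close> cancels the leading 1 of the complement; this
    accounts for the minus sign and for the sum starting at 1.\<close>
  also have "\<dots> = 1 + (\<Sum>k=1..g. \<Prod>j=1..k. inverse (1 - l ^ j))"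
    by (simp add: atMost_atLeast0 sum.atLeast_Suc_atMost)
  finally show ?thesis
    using proportion_eq_moment_sum[OF q(1), of g] by (simp add: l_def)
qed

lemma proportion_1:
  shows "real (card {T \<in> simil (1 :: 'a::{field,finite}) g. card (fixed T) \<noteq> 1}) / card (simil (1 :: 'a) g) =
    - (\<Sum>r=1..g. real CARD('a) ^ r * (\<Prod>j=1..r. inverse (1 - real CARD('a) ^ (2 * j))))"
proof -
  define l where "l = real CARD('a)"
  have l: "l > 1" using CARD_field_gt_1[where 'a = 'a] by (simp add: l_def)
  have "(\<Sum>k\<le>2 * g. (- 1) ^ k * avg (1 :: 'a) g (\<lambda>n. fall l k (real n)) / qfact l k) =
      (\<Sum>k\<le>2 * g. \<Sum>r\<le>g. (- 1) ^ k * moment_part l r k)"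
  proof (rule sum.cong[OF refl])
    fix k
    have "(- 1) ^ k * avg (1 :: 'a) g (\<lambda>n. fall l k (real n)) / qfact l k =
        (- 1) ^ k * (\<Sum>r\<le>g. moment_part l r k)"
      using qfact_pos[OF l, of k] unfolding l_def avg_fall_1[where 'a = 'a] by simp
    then show "(- 1) ^ k * avg (1 :: 'a) g (\<lambda>n. fall l k (real n)) / qfact l k =
        (\<Sum>r\<le>g. (- 1) ^ k * moment_part l r k)" by (simp only: sum_distrib_left)
  qed
  also have "\<dots> = (\<Sum>r\<le>g. \<Sum>k\<le>2 * g. (- 1) ^ k * moment_part l r k)"
    by (rule sum.swap)
  also have "\<dots> = (\<Sum>r\<le>g. (- l) ^ r / qfact2 l r)"
    by (rule sum.cong[OF refl]) (simp add: alternating_sum_moment_part[OF l])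
  also have "\<dots> = (\<Sum>r\<le>g. l ^ r * (\<Prod>j=1..r. inverse (1 - l ^ (2 * j))))"
  proof (rule sum.cong[OF refl])
    fix r
    show "(- l) ^ r / qfact2 l r = l ^ r * (\<Prod>j=1..r. inverse (1 - l ^ (2 * j)))"
      unfolding qfact2_def[OF l] prod_inverse_one_minus by (simp add: power_minus[of l])
  qed
  also have "\<dots> = 1 + (\<Sum>r=1..g. l ^ r * (\<Prod>j=1..r. inverse (1 - l ^ (2 * j))))"
    by (simp add: atMost_atLeast0 sum.atLeast_Suc_atMost)
  finally show ?thesis
    using proportion_eq_moment_sum[where 'a = 'a and q = 1, of g] by (simp add: l_def)
qed

section \<open>From matrices to linear maps\<close>

text \<open>Coordinates \<open>2 k\<close> and \<open>2 k + 1\<close> of a function correspond to the entries \<open>k\<close> and \<open>g + k\<close>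
  of a vector, so that passing from \<open>g\<close> to \<open>g + 1\<close> only appends coordinates.\<close>

definition coord_of :: "nat \<Rightarrow> nat \<Rightarrow> nat" where
  "coord_of g i = (if i < g then 2 * i else Suc (2 * (i - g)))"

definition entry_of :: "nat \<Rightarrow> nat \<Rightarrow> nat" where
  "entry_of g k = (if even k then k div 2 else g + k div 2)"

definition to_vec :: "nat \<Rightarrow> (nat \<Rightarrow> 'a) \<Rightarrow> 'a vec" where
  "to_vec g v = vec (2 * g) (\<lambda>i. v (coord_of g i))"

definition of_vec :: "nat \<Rightarrow> 'a::zero vec \<Rightarrow> nat \<Rightarrow> 'a" where
  "of_vec g x = (\<lambda>k. if k < 2 * g then x $ entry_of g k else 0)"

definition mat_map :: "nat \<Rightarrow> 'a::comm_ring_1 mat \<Rightarrow> (nat \<Rightarrow> 'a) \<Rightarrow> nat \<Rightarrow> 'a" where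
  "mat_map g M v = of_vec g (M *\<^sub>v to_vec g v)"

lemma coord_of_less: "i < 2 * g \<Longrightarrow> coord_of g i < 2 * g"
  by (auto simp: coord_of_def)

lemma entry_of_less: "k < 2 * g \<Longrightarrow> entry_of g k < 2 * g"
  by (auto simp: entry_of_def)

lemma entry_coord: "entry_of g (coord_of g i) = i"
  by (auto simp: entry_of_def coord_of_def)

lemma coord_of_eq_iff: "coord_of g i = coord_of g j \<longleftrightarrow> i = j"
  by (metis entry_coord)

lemma coord_entry: "k < 2 * g \<Longrightarrow> coord_of g (entry_of g k) = k"
  by (auto simp: entry_of_def coord_of_def elim: oddE)

lemma to_vec_carrier [simp]: "to_vec g v \<in> carrier_vec (2 * g)"
  by (simp add: to_vec_def)

lemma of_vec_in_coords: "of_vec g x \<in> coords (2 * g)"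
  by (simp add: of_vec_def coords_def)

lemma to_of_vec: "x \<in> carrier_vec (2 * g) \<Longrightarrow> to_vec g (of_vec g x) = x"
  by (intro eq_vecI) (auto simp: to_vec_def of_vec_def coord_of_less entry_coord)

lemma of_to_vec: "of_vec g (to_vec g v) = trunc (2 * g) v"
  by (auto simp: to_vec_def of_vec_def trunc_def entry_of_less coord_entry)

lemma to_vec_trunc: "to_vec g (trunc (2 * g) v) = to_vec g v"
  by (intro eq_vecI) (auto simp: to_vec_def trunc_def coord_of_less)

lemma to_vec_add: "to_vec g (u + v) = to_vec g u + to_vec g v" for u :: "nat \<Rightarrow> 'a::comm_ring_1"
  by (intro eq_vecI) (auto simp: to_vec_def)

lemma to_vec_scale: "to_vec g (scale c v) = c \<cdot>\<^sub>v to_vec g v" for c :: "'a::comm_ring_1"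
  by (intro eq_vecI) (auto simp: to_vec_def scale_def)

lemma of_vec_add:
  fixes x :: "'a::comm_ring_1 vec"
  shows "x \<in> carrier_vec (2 * g) \<Longrightarrow> y \<in> carrier_vec (2 * g) \<Longrightarrow> of_vec g (x + y) = of_vec g x + of_vec g y"
  by (auto simp: of_vec_def fun_eq_iff entry_of_less)

lemma of_vec_smult:
  fixes x :: "'a::comm_ring_1 vec"
  shows "x \<in> carrier_vec (2 * g) \<Longrightarrow> of_vec g (c \<cdot>\<^sub>v x) = scale c (of_vec g x)"
  by (auto simp: of_vec_def scale_def fun_eq_iff entry_of_less)

section \<open>The matrix Omega and the symplectic form\<close>

lemma Omega_carrier [simp]: "Omega_mat g \<in> carrier_mat (2 * g) (2 * g)"
  unfolding Omega_mat_def mult_2 by (intro four_block_carrier_mat) auto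

lemma Omega_entry:
  assumes "i < 2 * g" "j < 2 * g"
  shows "(Omega_mat g :: 'a::field mat) $$ (i, j) = (if j = g + i then 1 else if i = g + j then - 1 else 0)"
proof -
  have "Omega_mat g $$ (i, j) = (if i < g then if j < g then (0\<^sub>m g g :: 'a mat) $$ (i, j)
      else 1\<^sub>m g $$ (i, j - g) else if j < g then (- 1\<^sub>m g) $$ (i - g, j) else 0\<^sub>m g g $$ (i - g, j - g))"
    using assms unfolding Omega_mat_def by (subst index_mat_four_block) simp_all
  then show ?thesis using assms by (cases "i < g"; cases "j < g") auto
qed

lemma sum_lessThan_double: "(\<Sum>i<2 * g. f i) = (\<Sum>i<g. f i) + (\<Sum>i<g. f (g + i))"
  for f :: "nat \<Rightarrow> 'a::comm_monoid_add"
  using sum.atLeastLessThan_concat[of 0 g "2 * g" f] sum.atLeastLessThan_shift_0[of f g "2 * g"]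
  by (simp add: atLeast0LessThan comp_def)

lemma Omega_mult_vec:
  fixes x :: "'a::field vec"
  assumes x: "x \<in> carrier_vec (2 * g)" and i: "i < g"
  shows "(Omega_mat g *\<^sub>v x) $ i = x $ (g + i)" "(Omega_mat g *\<^sub>v x) $ (g + i) = - (x $ i)"
proof -
  have e: "(Omega_mat g *\<^sub>v x) $ j =
      (\<Sum>k<2 * g. (if k = g + j then x $ k else 0) + (if j = g + k then - x $ k else 0))" if "j < 2 * g" for j
  proof -
    have "(Omega_mat g *\<^sub>v x) $ j = (\<Sum>k<2 * g. Omega_mat g $$ (j, k) * x $ k)"
      using x that carrier_matD[OF Omega_carrier[of g, where 'a = 'a]]
      by (simp add: scalar_prod_def atLeast0LessThan)
    also have "\<dots> = (\<Sum>k<2 * g. (if k = g + j then x $ k else 0) + (if j = g + k then - x $ k else 0))"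
      using that by (intro sum.cong) (auto simp: Omega_entry)
    finally show ?thesis .
  qed
  have "(\<Sum>k<2 * g. if i = g + k then - x $ k else 0) = 0"
    using i by (intro sum.neutral) auto
  then show "(Omega_mat g *\<^sub>v x) $ i = x $ (g + i)"
    using i by (simp add: e sum.distrib)
  have "(\<Sum>k<2 * g. if k = g + (g + i) then x $ k else 0) = 0"
    by (intro sum.neutral) auto
  moreover have "(\<Sum>k<2 * g. if g + i = g + k then - x $ k else 0) = - x $ i"
    using i by simp
  ultimately show "(Omega_mat g *\<^sub>v x) $ (g + i) = - (x $ i)"
    using i by (simp only: e sum.distrib) simp
qed

lemma sympl_eq_Omega:
  fixes u :: "nat \<Rightarrow> 'a::field"
  shows "sympl g u v = to_vec g u \<bullet> (Omega_mat g *\<^sub>v to_vec g v)"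
proof -
  have d: "dim_vec (Omega_mat g *\<^sub>v to_vec g v) = 2 * g"
    using carrier_matD[OF Omega_carrier[of g, where 'a = 'a]] by simp
  have "to_vec g u \<bullet> (Omega_mat g *\<^sub>v to_vec g v) =
      (\<Sum>i<2 * g. to_vec g u $ i * (Omega_mat g *\<^sub>v to_vec g v) $ i)"
    unfolding scalar_prod_def d atLeast0LessThan ..
  also have "\<dots> = (\<Sum>i<g. u (2 * i) * v (Suc (2 * i))) + (\<Sum>i<g. u (Suc (2 * i)) * - v (2 * i))"
    unfolding sum_lessThan_double
    by (intro arg_cong2[of _ _ _ _ "(+)"] sum.cong)
      (simp_all add: Omega_mult_vec, simp_all add: to_vec_def coord_of_def)
  finally show ?thesis by (simp add: sympl_def sum_subtractf sum_negf)
qed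

lemma Omega_square: "Omega_mat g * Omega_mat g = - (1\<^sub>m (2 * g) :: 'a::field mat)"
proof -
  have "Omega_mat g * Omega_mat g = four_block_mat (- 1\<^sub>m g) (0\<^sub>m g g) (0\<^sub>m g g) (- 1\<^sub>m g :: 'a mat)"
    unfolding Omega_mat_def by (subst mult_four_block_mat[where ?nr1.0 = g and ?n1.0 = g and ?n2.0 = g
      and ?nr2.0 = g and ?nc1.0 = g and ?nc2.0 = g]) auto
  also have "\<dots> = - 1\<^sub>m (2 * g)" by (rule eq_matI) auto
  finally show ?thesis .
qed

lemma mat_eqI_scalar_prod:
  fixes A :: "'a::comm_ring_1 mat"
  assumes A: "A \<in> carrier_mat n n" "B \<in> carrier_mat n n"
    and eq: "\<And>x y. x \<in> carrier_vec n \<Longrightarrow> y \<in> carrier_vec n \<Longrightarrow> x \<bullet> (A *\<^sub>v y) = x \<bullet> (B *\<^sub>v y)"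
  shows "A = B"
proof (rule eq_matI)
  have entry: "unit_vec n i \<bullet> (C *\<^sub>v unit_vec n j) = C $$ (i, j)"
    if "i < n" "j < n" and C: "C \<in> carrier_mat n n" for C :: "'a mat" and i j
    using that by simp
  fix i j assume ij: "i < dim_row B" "j < dim_col B"
  then show "A $$ (i, j) = B $$ (i, j)"
    using entry[of i j A] entry[of i j B] eq[of "unit_vec n i" "unit_vec n j"] A by simp
qed (use A in auto)

lemma smult_mat_mult_vec:
  fixes A :: "'a::comm_ring_1 mat"
  assumes "A \<in> carrier_mat m n" "x \<in> carrier_vec n"
  shows "(c \<cdot>\<^sub>m A) *\<^sub>v x = c \<cdot>\<^sub>v (A *\<^sub>v x)"
  using assms by (intro eq_vecI) (auto simp: scalar_prod_def sum_distrib_left mult.assoc)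

text \<open>A matrix is determined by its bilinear form, and the form of the triple product at
  \<open>x\<close> and \<open>y\<close> is the form of \<open>Omega_mat g\<close> at
  \<open>M *\<^sub>v x\<close> and \<open>M *\<^sub>v y\<close>.\<close>

lemma Omega_form_iff:
  fixes M :: "'a::field mat"
  assumes M: "M \<in> carrier_mat (2 * g) (2 * g)"
  shows "transpose_mat M * Omega_mat g * M = q \<cdot>\<^sub>m Omega_mat g \<longleftrightarrow>
    (\<forall>u v. sympl g (mat_map g M u) (mat_map g M v) = q * sympl g u v)"
proof -
  let ?W = "Omega_mat g :: 'a mat" and ?n = "2 * g"
  have tM: "transpose_mat M \<in> carrier_mat ?n ?n" using M by simp
  have L: "x \<bullet> ((transpose_mat M * ?W * M) *\<^sub>v y) = (M *\<^sub>v x) \<bullet> (?W *\<^sub>v (M *\<^sub>v y))"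
    if x: "x \<in> carrier_vec ?n" and y: "y \<in> carrier_vec ?n" for x y
  proof -
    have My1: "M *\<^sub>v y \<in> carrier_vec ?n" by (rule mult_mat_vec_carrier[OF M y])
    note My = My1 mult_mat_vec_carrier[OF Omega_carrier[of g] My1]
    have "(transpose_mat M * ?W * M) *\<^sub>v y = transpose_mat M *\<^sub>v (?W *\<^sub>v (M *\<^sub>v y))"
      using assoc_mult_mat_vec[OF mult_carrier_mat[OF tM Omega_carrier] M y]
        assoc_mult_mat_vec[OF tM Omega_carrier My(1)] by simp
    then have "x \<bullet> ((transpose_mat M * ?W * M) *\<^sub>v y) = (transpose_mat M *\<^sub>v (?W *\<^sub>v (M *\<^sub>v y))) \<bullet> x"
      using comm_scalar_prod[OF x mult_mat_vec_carrier[OF tM My(2)]] by simp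
    also have "\<dots> = (?W *\<^sub>v (M *\<^sub>v y)) \<bullet> (M *\<^sub>v x)"
      by (rule transpose_vec_mult_scalar[OF M x My(2)])
    also have "\<dots> = (M *\<^sub>v x) \<bullet> (?W *\<^sub>v (M *\<^sub>v y))"
      by (rule comm_scalar_prod[OF My(2) mult_mat_vec_carrier[OF M x]])
    finally show ?thesis .
  qed
  have R: "x \<bullet> ((q \<cdot>\<^sub>m ?W) *\<^sub>v y) = q * (x \<bullet> (?W *\<^sub>v y))"
    if x: "x \<in> carrier_vec ?n" and y: "y \<in> carrier_vec ?n" for x y
    unfolding smult_mat_mult_vec[OF Omega_carrier y]
    by (rule scalar_prod_smult_right) (use x y in \<open>simp add: carrier_matD[OF Omega_carrier]\<close>)
  have S: "sympl g (mat_map g M u) (mat_map g M v) = (M *\<^sub>v to_vec g u) \<bullet> (?W *\<^sub>v (M *\<^sub>v to_vec g v))" for u v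
    using M by (simp add: sympl_eq_Omega mat_map_def to_of_vec[OF mult_mat_vec_carrier[OF M]])
  show ?thesis
  proof
    assume eq: "transpose_mat M * ?W * M = q \<cdot>\<^sub>m ?W"
    show "\<forall>u v. sympl g (mat_map g M u) (mat_map g M v) = q * sympl g u v"
      by (simp only: S L[OF to_vec_carrier to_vec_carrier, symmetric] eq
        R[OF to_vec_carrier to_vec_carrier] sympl_eq_Omega[symmetric] simp_thms)
  next
    assume s: "\<forall>u v. sympl g (mat_map g M u) (mat_map g M v) = q * sympl g u v"
    show "transpose_mat M * ?W * M = q \<cdot>\<^sub>m ?W"
    proof (rule mat_eqI_scalar_prod)
      show "transpose_mat M * ?W * M \<in> carrier_mat ?n ?n"
        by (rule mult_carrier_mat[OF mult_carrier_mat[OF tM Omega_carrier] M])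
      show "q \<cdot>\<^sub>m ?W \<in> carrier_mat ?n ?n" by simp
      fix x y :: "'a vec" assume x: "x \<in> carrier_vec ?n" and y: "y \<in> carrier_vec ?n"
      show "x \<bullet> ((transpose_mat M * ?W * M) *\<^sub>v y) = x \<bullet> ((q \<cdot>\<^sub>m ?W) *\<^sub>v y)"
        using s[rule_format, of "of_vec g x" "of_vec g y"]
        unfolding S L[OF x y] R[OF x y] unfolding sympl_eq_Omega to_of_vec[OF x] to_of_vec[OF y] .
    qed
  qed
qed

text \<open>Since Omega squares to -1, multiplying the hypothesis on the left by
  \<open>- inverse q\<close> times Omega exhibits a left inverse of \<open>M\<close>.\<close>

lemma invertible_if_Omega_form:
  fixes M :: "'a::field mat"
  assumes M: "M \<in> carrier_mat (2 * g) (2 * g)" and q: "q \<noteq> 0"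
    and eq: "transpose_mat M * Omega_mat g * M = q \<cdot>\<^sub>m Omega_mat g"
  shows "invertible_mat M"
proof -
  let ?W = "Omega_mat g :: 'a mat" and ?n = "2 * g"
  let ?L = "(- inverse q) \<cdot>\<^sub>m (?W * (transpose_mat M * ?W))"
  have c: "transpose_mat M * ?W \<in> carrier_mat ?n ?n" "?W * (transpose_mat M * ?W) \<in> carrier_mat ?n ?n"
    using mult_carrier_mat[OF transpose_carrier_mat[THEN iffD2, OF M] Omega_carrier]
      mult_carrier_mat[OF Omega_carrier mult_carrier_mat[OF transpose_carrier_mat[THEN iffD2, OF M] Omega_carrier]]
    by blast+
  then have L: "?L \<in> carrier_mat ?n ?n" by simp
  have "?L * M = (- inverse q) \<cdot>\<^sub>m (?W * (transpose_mat M * ?W) * M)"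
    using mult_smult_assoc_mat[OF c(2) M] by simp
  also have "?W * (transpose_mat M * ?W) * M = ?W * (q \<cdot>\<^sub>m ?W)"
    using assoc_mult_mat[OF Omega_carrier c(1) M] eq by simp
  also have "\<dots> = q \<cdot>\<^sub>m (?W * ?W)"
    by (rule mult_smult_distrib[OF Omega_carrier Omega_carrier])
  also have "(- inverse q) \<cdot>\<^sub>m (q \<cdot>\<^sub>m (?W * ?W)) = 1\<^sub>m ?n"
    using q by (intro eq_matI) (auto simp: Omega_square)
  finally have LM: "?L * M = 1\<^sub>m ?n" .
  then have "inverts_mat M ?L \<and> inverts_mat ?L M"
    using mat_mult_left_right_inverse[OF L M LM] carrier_matD[OF M] carrier_matD[OF L]
    unfolding inverts_mat_def by simp
  then show ?thesis
    using carrier_matD[OF M] unfolding invertible_mat_def square_mat.simps by auto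
qed

lemma lin_trunc_expand:
  assumes T: "lin T"
  shows "T (trunc n v) k = (\<Sum>j<n. v j * T (unit_at j) k)"
proof (induction n)
  case 0
  have "trunc 0 v = 0" by (simp add: trunc_def fun_eq_iff)
  then show ?case by (simp only: lin_zero[OF T]) simp
next
  case (Suc n)
  have "trunc (Suc n) v = trunc n v + scale (v n) (unit_at n)"
    by (auto simp: trunc_def scale_def unit_at_def fun_eq_iff less_Suc_eq)
  then have "T (trunc (Suc n) v) = T (trunc n v) + scale (v n) (T (unit_at n))"
    using T by (simp add: lin_def)
  then show ?case using Suc by (simp add: scale_def)
qed

lemma bij_betw_mat_map:
  assumes q: "of_nat q \<noteq> (0 :: 'a::field)"
  shows "bij_betw (mat_map g) (GSp q g) (simil (of_nat q :: 'a) g)"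
proof (rule bij_betw_byWitness[where
    f' = "\<lambda>T. mat (2 * g) (2 * g) (\<lambda>(i, j). T (unit_at (coord_of g j)) (coord_of g i))"])
  let ?R = "\<lambda>T. mat (2 * g) (2 * g) (\<lambda>(i, j). T (unit_at (coord_of g j)) (coord_of g i)) :: 'a mat"
  have RM: "?R (mat_map g M) = M" if M: "M \<in> carrier_mat (2 * g) (2 * g)" for M
  proof (rule eq_matI)
    fix i j assume "i < dim_row M" "j < dim_col M"
    then have ij: "i < 2 * g" "j < 2 * g" using M by auto
    have "to_vec g (unit_at (coord_of g j)) = (unit_vec (2 * g) j :: 'a vec)"
      using ij(2) by (intro eq_vecI) (simp_all add: to_vec_def unit_at_def coord_of_eq_iff)
    then show "?R (mat_map g M) $$ (i, j) = M $$ (i, j)"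
      using ij M by (simp add: mat_map_def of_vec_def coord_of_less entry_coord)
  qed (use M in auto)
  then show "\<forall>M\<in>GSp q g. ?R (mat_map g M) = M" by (simp add: GSp_def)
  have MR: "mat_map g (?R T) = T" if T: "T \<in> simil (of_nat q) g" for T
  proof
    fix v
    have "?R T *\<^sub>v to_vec g v = to_vec g (T v)"
    proof (rule eq_vecI)
      fix i assume "i < dim_vec (to_vec g (T v))"
      then have i: "i < 2 * g" by (simp add: to_vec_def)
      then have "(?R T *\<^sub>v to_vec g v) $ i =
          (\<Sum>j<2 * g. v (coord_of g j) * T (unit_at (coord_of g j)) (coord_of g i))"
        by (simp add: scalar_prod_def to_vec_def atLeast0LessThan mult.commute)
      \<comment> \<open>\<open>coord_of g\<close> permutes the indices below \<open>2 * g\<close>,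
        with inverse \<open>entry_of g\<close>.\<close>
      also have "\<dots> = (\<Sum>k<2 * g. v k * T (unit_at k) (coord_of g i))"
        by (rule sum.reindex_bij_witness[where i = "entry_of g" and j = "coord_of g"])
          (auto simp: entry_coord coord_entry coord_of_less entry_of_less)
      also have "\<dots> = T (trunc (2 * g) v) (coord_of g i)"
        by (rule lin_trunc_expand[OF similD(1)[OF T], symmetric])
      finally show "(?R T *\<^sub>v to_vec g v) $ i = to_vec g (T v) $ i"
        using i by (simp add: similD(6)[OF T] to_vec_def)
    qed (simp add: to_vec_def)
    then show "mat_map g (?R T) v = T v"
      by (simp add: mat_map_def of_to_vec similD(7)[OF T])
  qed
  then show "\<forall>T\<in>simil (of_nat q) g. mat_map g (?R T) = T" by simp
  show "mat_map g ` GSp q g \<subseteq> simil (of_nat q :: 'a) g"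
  proof (rule image_subsetI)
    fix M :: "'a mat" assume "M \<in> GSp q g"
    then have M: "M \<in> carrier_mat (2 * g) (2 * g)"
      and form: "transpose_mat M * Omega_mat g * M = of_nat q \<cdot>\<^sub>m Omega_mat g"
      unfolding GSp_def by blast+
    note s = iffD1[OF Omega_form_iff[OF M] form]
    have c: "M *\<^sub>v to_vec g v \<in> carrier_vec (2 * g)" for v
      by (rule mult_mat_vec_carrier[OF M to_vec_carrier])
    have "lin (mat_map g M)"
      unfolding lin_def mat_map_def to_vec_add to_vec_scale
        mult_add_distrib_mat_vec[OF M to_vec_carrier to_vec_carrier] mult_mat_vec[OF M to_vec_carrier]
        of_vec_add[OF c c] of_vec_smult[OF c] by simp
    moreover have "mat_map g M (trunc (2 * g) v) = mat_map g M v" for v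
      by (simp add: mat_map_def to_vec_trunc)
    moreover have "trunc (2 * g) (mat_map g M v) = mat_map g M v" for v
      by (simp add: mat_map_def trunc_eq_iff of_vec_in_coords)
    ultimately show "mat_map g M \<in> simil (of_nat q) g" using s by (simp add: simil_def)
  qed
  show "?R ` simil (of_nat q) g \<subseteq> GSp q g"
  proof (rule image_subsetI)
    fix T assume T: "T \<in> simil (of_nat q :: 'a) g"
    have c: "?R T \<in> carrier_mat (2 * g) (2 * g)" by simp
    have "transpose_mat (?R T) * Omega_mat g * ?R T = of_nat q \<cdot>\<^sub>m Omega_mat g"
      unfolding Omega_form_iff[OF c] MR[OF T] using similD(9)[OF T] by blast
    then show "?R T \<in> GSp q g"
      using invertible_if_Omega_form[OF c q] c unfolding GSp_def by blast
  qed
qed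

text \<open>The zero vector is always fixed, so a count of 1 means that no eigenvector exists. For
  \<open>g = 0\<close> the count is 1, in agreement with the empty matrix having no
  eigenvalue.\<close>

lemma eigenvalue_1_iff:
  fixes M :: "'a::{field,finite} mat"
  assumes M: "M \<in> GSp q g" and q: "of_nat q \<noteq> (0 :: 'a)"
  shows "eigenvalue M 1 \<longleftrightarrow> card (fixed (mat_map g M)) \<noteq> 1"
proof -
  have c: "M \<in> carrier_mat (2 * g) (2 * g)" using M by (simp add: GSp_def)
  have T: "mat_map g M \<in> simil (of_nat q) g"
    using bij_betwE[OF bij_betw_mat_map[OF q]] M by blast
  have "eigenvalue M 1 \<longleftrightarrow> (\<exists>v\<in>fixed (mat_map g M). v \<noteq> 0)"
  proof
    assume "eigenvalue M 1"
    then obtain x where x: "x \<in> carrier_vec (2 * g)" "x \<noteq> 0\<^sub>v (2 * g)" "M *\<^sub>v x = x"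
      using c by (auto simp: eigenvalue_def eigenvector_def)
    have "of_vec g x \<in> fixed (mat_map g M)" by (simp add: fixed_def mat_map_def to_of_vec[OF x(1)] x(3))
    moreover have "to_vec g (0 :: nat \<Rightarrow> 'a) = 0\<^sub>v (2 * g)" by (intro eq_vecI) (auto simp: to_vec_def)
    then have "of_vec g x \<noteq> 0" using x(2) to_of_vec[OF x(1)] by auto
    ultimately show "\<exists>v\<in>fixed (mat_map g M). v \<noteq> 0" by blast
  next
    assume "\<exists>v\<in>fixed (mat_map g M). v \<noteq> 0"
    then obtain v where v: "mat_map g M v = v" "v \<noteq> 0" by (auto simp: fixed_def)
    have "to_vec g (mat_map g M v) = M *\<^sub>v to_vec g v"
      unfolding mat_map_def by (rule to_of_vec[OF mult_mat_vec_carrier[OF c to_vec_carrier]])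
    then have "M *\<^sub>v to_vec g v = to_vec g v" by (simp only: v(1))
    moreover have "to_vec g v \<noteq> 0\<^sub>v (2 * g)"
    proof
      assume z: "to_vec g v = 0\<^sub>v (2 * g)"
      \<comment> \<open>Being its own image, \<open>v\<close> is supported on the first
        \<open>2 * g\<close> coordinates, so no information is lost in
        \<open>to_vec g v\<close>.\<close>
      have "v = of_vec g (to_vec g v)"
        using similD(7)[OF T, of v] by (simp add: of_to_vec v(1))
      also have "\<dots> = 0" unfolding z by (auto simp: of_vec_def entry_of_less fun_eq_iff)
      finally show False using v(2) by simp
    qed
    ultimately show "eigenvalue M 1"
      using c unfolding eigenvalue_def eigenvector_def by (intro exI[of _ "to_vec g v"]) simp
  qed
  also have "\<dots> \<longleftrightarrow> fixed (mat_map g M) \<noteq> {0}" using zero_in_fixed[OF T] by auto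
  also have "\<dots> \<longleftrightarrow> card (fixed (mat_map g M)) \<noteq> 1"
    using zero_in_fixed[OF T] by (auto simp: card_1_singleton_iff)
  finally show ?thesis .
qed

lemma proportion_eq_simil:
  fixes q g :: nat
  assumes q: "of_nat q \<noteq> (0 :: 'a::{field,finite})"
  shows "real (card {M \<in> (GSp q g :: 'a mat set). eigenvalue M 1}) / card (GSp q g :: 'a mat set) =
    real (card {T \<in> simil (of_nat q :: 'a) g. card (fixed T) \<noteq> 1}) / card (simil (of_nat q :: 'a) g)"
proof -
  note bij = bij_betw_mat_map[OF q, of g]
  have "mat_map g ` {M \<in> GSp q g. eigenvalue M 1} = {T \<in> simil (of_nat q :: 'a) g. card (fixed T) \<noteq> 1}"
    using bij_betw_imp_surj_on[OF bij, symmetric] eigenvalue_1_iff[OF _ q] by auto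
  moreover have "inj_on (mat_map g) {M \<in> (GSp q g :: 'a mat set). eigenvalue M 1}"
    using bij_betw_imp_inj_on[OF bij] by (rule inj_on_subset) auto
  ultimately have "card {M \<in> (GSp q g :: 'a mat set). eigenvalue M 1} =
      card {T \<in> simil (of_nat q :: 'a) g. card (fixed T) \<noteq> 1}"
    using card_image by fastforce
  then show ?thesis using bij_betw_same_card[OF bij] by simp
qed

theorem theorem5p3:
  fixes q l g :: nat
  assumes "primepow q" and "prime l" and "CARD('p::prime_card) = l" and "\<not> l dvd q"
  shows "eigenvalue_one_proportion TYPE('p) q g =
    (if l dvd q - 1
     then - (\<Sum>r=1..g. real l ^ r * (\<Prod>j=1..r. inverse (1 - real l ^ (2 * j))))
     else - (\<Sum>r=1..g. \<Prod>j=1..r. inverse (1 - real l ^ j)))"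
proof -
  \<comment> \<open>The field has characteristic \<open>l\<close>, which turns the divisibility
    conditions on \<open>q\<close> and \<open>q - 1\<close> into the conditions on the
    multiplier.\<close>
  have char: "of_nat n = (0 :: 'p mod_ring) \<longleftrightarrow> l dvd n" for n
    using assms(3) by (simp add: of_nat_eq_0_iff_char_dvd)
  have q0: "of_nat q \<noteq> (0 :: 'p mod_ring)" using assms(4) by (simp add: char)
  \<comment> \<open>Positivity makes the truncated subtraction in \<open>q - 1\<close> agree with
    subtraction in the field.\<close>
  have "q > 0" using assms(4) by (cases q) auto
  then have "of_nat q = (1 :: 'p mod_ring) \<longleftrightarrow> of_nat (q - 1) = (0 :: 'p mod_ring)"
    by (simp add: of_nat_diff)
  then have q1: "of_nat q = (1 :: 'p mod_ring) \<longleftrightarrow> l dvd q - 1" by (simp only: char)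
  show ?thesis
  proof (cases "l dvd q - 1")
    case True
    then have "of_nat q = (1 :: 'p mod_ring)" using q1 by simp
    then show ?thesis
      unfolding eigenvalue_one_proportion_def proportion_eq_simil[OF q0]
      using proportion_1[where 'a = "'p mod_ring", of g] True by (simp add: assms(3))
  next
    case False
    then have "of_nat q \<noteq> (1 :: 'p mod_ring)" using q1 by simp
    then show ?thesis
      unfolding eigenvalue_one_proportion_def proportion_eq_simil[OF q0]
      using proportion_neq_1[OF q0, of g] False by (simp add: assms(3))
  qed
qed

end
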